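(* Let $R$ be a commutative noetherian ring of prime characteristic $p$ satisfying $(S_2)$. Assume that one of the following holds: (i) $R$ is $F$-pure; or (ii) $R$ is weakly normal and Mori. Then $R$ is weakly Arf.
   Context: $(S_2)$ means $\operatorname{depth}(R_{\mathfrak{p}})\geq\min\{2,\operatorname{ht}(\mathfrak{p})\}$ for all $\mathfrak{p}\in\operatorname{Spec}(R)$. $\overline{R}$ is the integral closure of $R$ in its total quotient ring $Q(R)$. $R$ is $F$-pure if the Frobenius map $F:R\to R$ is a pure ring homomorphism, i.e. stays injective after tensoring over $R$ with any $R$-module. $R$ is Mori if it is reduced and $\overline{R}$ is finitely generated as an $R$-module. An integral extension of rings $i:A\hookrightarrow B$ is weakly subintegral if it induces a bijection $\operatorname{Spec}(B)\to\operatorname{Spec}(A)$ and for each $\mathfrak{p}\in\operatorname{Spec}(B)$ the induced map of residue fields $k(i^{-1}(\mathfrak{p}))\to k(\mathfrak{p})$ is a purely inseparable field extension. ${}^{\ast}R$ is the unique largest subextension of $R$ in $\overline{R}$ such that $R\subset{}^{\ast}R$ is weakly subintegral; $R$ is weakly normal if $R={}^{\ast}R$. $R$ is weakly Arf if for every non-zerodivisor $x$ of $R$ and all $y,z\in R$ with $y/x,\,z/x\in\overline{R}$, one has $yz/x\in R$. *)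

theory Defs
  imports
    "HOL-Algebra.Algebra"
    "HOL-Library.Extended_Nat"
    "HOL-Computational_Algebra.Primes"
begin

definition Spec :: "('a, 'c) ring_scheme \<Rightarrow> 'a set set" where
  "Spec R = {P. primeideal P R}"

definition nonzerodivisors :: "('a, 'c) ring_scheme \<Rightarrow> 'a set" where
  "nonzerodivisors R =
     {x \<in> carrier R. \<forall>a \<in> carrier R. x \<otimes>\<^bsub>R\<^esub> a = \<zero>\<^bsub>R\<^esub> \<longrightarrow> a = \<zero>\<^bsub>R\<^esub>}"

definition reduced_ring :: "('a, 'c) ring_scheme \<Rightarrow> bool" where
  "reduced_ring R \<longleftrightarrow>
     (\<forall>a \<in> carrier R. \<forall>n::nat. a [^]\<^bsub>R\<^esub> n = \<zero>\<^bsub>R\<^esub> \<longrightarrow> a = \<zero>\<^bsub>R\<^esub>)"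

text \<open>The order of an element is 0 in the library when no positive multiple vanishes,
  so this is 0 in characteristic zero.\<close>

definition ring_char :: "('a, 'c) ring_scheme \<Rightarrow> nat" where
  "ring_char R = group.ord (add_monoid R) \<one>\<^bsub>R\<^esub>"


section \<open>Localization\<close>

text \<open>Fractions with denominators in a multiplicative set \<open>S\<close>, as equivalence classes of pairs
  (numerator, denominator). In the ring operations the unions over representatives are unions of
  one and the same class.\<close>

definition frac_rel :: "('a, 'c) ring_scheme \<Rightarrow> 'a set \<Rightarrow> (('a \<times> 'a) \<times> ('a \<times> 'a)) set" where
  "frac_rel R S =
     {((a, s), (b, t)). a \<in> carrier R \<and> s \<in> S \<and> b \<in> carrier R \<and> t \<in> S \<and>
        (\<exists>u \<in> S. u \<otimes>\<^bsub>R\<^esub> (t \<otimes>\<^bsub>R\<^esub> a \<ominus>\<^bsub>R\<^esub> s \<otimes>\<^bsub>R\<^esub> b) = \<zero>\<^bsub>R\<^esub>)}"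

definition mk_frac :: "('a, 'c) ring_scheme \<Rightarrow> 'a set \<Rightarrow> 'a \<Rightarrow> 'a \<Rightarrow> ('a \<times> 'a) set" where
  "mk_frac R S a s = frac_rel R S `` {(a, s)}"

definition localization :: "('a, 'c) ring_scheme \<Rightarrow> 'a set \<Rightarrow> ('a \<times> 'a) set ring" where
  "localization R S =
     \<lparr>carrier = (carrier R \<times> S) // frac_rel R S,
      monoid.mult = (\<lambda>U V. \<Union>(a, s)\<in>U. \<Union>(b, t)\<in>V. mk_frac R S (a \<otimes>\<^bsub>R\<^esub> b) (s \<otimes>\<^bsub>R\<^esub> t)),
      one = mk_frac R S \<one>\<^bsub>R\<^esub> \<one>\<^bsub>R\<^esub>,
      ring.zero = mk_frac R S \<zero>\<^bsub>R\<^esub> \<one>\<^bsub>R\<^esub>,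
      add = (\<lambda>U V. \<Union>(a, s)\<in>U. \<Union>(b, t)\<in>V.
               mk_frac R S (t \<otimes>\<^bsub>R\<^esub> a \<oplus>\<^bsub>R\<^esub> s \<otimes>\<^bsub>R\<^esub> b) (s \<otimes>\<^bsub>R\<^esub> t))\<rparr>"

text \<open>The map of localizations induced by a ring homomorphism \<open>f\<close> into \<open>B\<close> that sends the
  denominators into \<open>T\<close>.\<close>

definition localization_map ::
  "('b, 'd) ring_scheme \<Rightarrow> 'b set \<Rightarrow> ('a \<Rightarrow> 'b) \<Rightarrow> ('a \<times> 'a) set \<Rightarrow> ('b \<times> 'b) set" where
  "localization_map B T f U = (\<Union>(a, s)\<in>U. mk_frac B T (f a) (f s))"

definition local_at :: "('a, 'c) ring_scheme \<Rightarrow> 'a set \<Rightarrow> ('a \<times> 'a) set ring" where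
  "local_at R P = localization R (carrier R - P)"

definition total_quotient_ring :: "('a, 'c) ring_scheme \<Rightarrow> ('a \<times> 'a) set ring" where
  "total_quotient_ring R = localization R (nonzerodivisors R)"

definition quot_elem :: "('a, 'c) ring_scheme \<Rightarrow> 'a \<Rightarrow> 'a \<Rightarrow> ('a \<times> 'a) set" where
  "quot_elem R a x = mk_frac R (nonzerodivisors R) a x"

definition quot_embed :: "('a, 'c) ring_scheme \<Rightarrow> 'a \<Rightarrow> ('a \<times> 'a) set" where
  "quot_embed R a = quot_elem R a \<one>\<^bsub>R\<^esub>"


section \<open>Height, depth and Serre's condition\<close>

definition height :: "('a, 'c) ring_scheme \<Rightarrow> 'a set \<Rightarrow> enat" where
  "height R P =
     Sup {enat n | n. \<exists>C :: nat \<Rightarrow> 'a set.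
            (\<forall>i \<le> n. C i \<in> Spec R) \<and> (\<forall>i < n. C i \<subset> C (Suc i)) \<and> C n = P}"

text \<open>Each \<open>xs ! i\<close> is a nonzerodivisor modulo the ideal generated by its predecessors, and the
  quotient by the whole sequence is not zero.\<close>

definition regular_sequence :: "('a, 'c) ring_scheme \<Rightarrow> 'a list \<Rightarrow> bool" where
  "regular_sequence R xs \<longleftrightarrow>
     set xs \<subseteq> carrier R \<and>
     (\<forall>i < length xs. \<forall>a \<in> carrier R.
        xs ! i \<otimes>\<^bsub>R\<^esub> a \<in> genideal R (set (take i xs)) \<longrightarrow> a \<in> genideal R (set (take i xs))) \<and>
     genideal R (set xs) \<noteq> carrier R"

text \<open>For local rings only: the maximal ideal is then the set of non-units.\<close>

definition local_depth :: "('a, 'c) ring_scheme \<Rightarrow> enat" where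
  "local_depth A =
     Sup {enat (length xs) | xs. regular_sequence A xs \<and> set xs \<subseteq> carrier A - Units A}"

definition serre_condition :: "nat \<Rightarrow> ('a, 'c) ring_scheme \<Rightarrow> bool" where
  "serre_condition n R \<longleftrightarrow>
     (\<forall>P \<in> Spec R. local_depth (local_at R P) \<ge> min (enat n) (height R P))"


section \<open>Tensor products and purity\<close>

text \<open>A ring \<open>B\<close> as a module over the source of a ring homomorphism \<open>h\<close> into \<open>B\<close>.\<close>

definition module_via :: "('a \<Rightarrow> 'b) \<Rightarrow> ('b, 'd) ring_scheme \<Rightarrow> ('a, 'b) module" where
  "module_via h B =
     \<lparr>carrier = carrier B, monoid.mult = monoid.mult B,
      one = \<one>\<^bsub>B\<^esub>, ring.zero = \<zero>\<^bsub>B\<^esub>, add = add B,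
      smult = (\<lambda>a b. h a \<otimes>\<^bsub>B\<^esub> b)\<rparr>"

text \<open>The tensor product of two modules over \<open>A\<close>, as an abelian group: the free abelian group on
  pairs modulo the bilinearity relations.\<close>

definition tensor_free :: "('a, 'n) module \<Rightarrow> ('a, 'm) module \<Rightarrow> ('n \<times> 'm \<Rightarrow>\<^sub>0 int) monoid" where
  "tensor_free N M = free_Abelian_group (carrier N \<times> carrier M)"

definition tensor_rels ::
  "('a, 'c) ring_scheme \<Rightarrow> ('a, 'n) module \<Rightarrow> ('a, 'm) module \<Rightarrow> ('n \<times> 'm \<Rightarrow>\<^sub>0 int) set" where
  "tensor_rels A N M = generate (tensor_free N M)
     ({frag_of (x \<oplus>\<^bsub>N\<^esub> x', y) - frag_of (x, y) - frag_of (x', y) | x x' y.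
         x \<in> carrier N \<and> x' \<in> carrier N \<and> y \<in> carrier M} \<union>
      {frag_of (x, y \<oplus>\<^bsub>M\<^esub> y') - frag_of (x, y) - frag_of (x, y') | x y y'.
         x \<in> carrier N \<and> y \<in> carrier M \<and> y' \<in> carrier M} \<union>
      {frag_of (a \<odot>\<^bsub>N\<^esub> x, y) - frag_of (x, a \<odot>\<^bsub>M\<^esub> y) | a x y.
         a \<in> carrier A \<and> x \<in> carrier N \<and> y \<in> carrier M})"

definition tensor_product ::
  "('a, 'c) ring_scheme \<Rightarrow> ('a, 'n) module \<Rightarrow> ('a, 'm) module \<Rightarrow>
     ('n \<times> 'm \<Rightarrow>\<^sub>0 int) set monoid" where
  "tensor_product A N M = tensor_free N M Mod tensor_rels A N M"

text \<open>For an \<open>A\<close>-linear \<open>f\<close> into \<open>N'\<close>, the map \<open>f \<otimes> M\<close> into \<open>N' \<otimes> M\<close>; again a union of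
  representatives' images that are all the same coset.\<close>

definition tensor_map ::
  "('a, 'c) ring_scheme \<Rightarrow> ('a, 'k) module \<Rightarrow> ('a, 'm) module \<Rightarrow> ('n \<Rightarrow> 'k) \<Rightarrow>
     ('n \<times> 'm \<Rightarrow>\<^sub>0 int) set \<Rightarrow> ('k \<times> 'm \<Rightarrow>\<^sub>0 int) set" where
  "tensor_map A N' M f U =
     (\<Union>u\<in>U. tensor_rels A N' M #>\<^bsub>tensor_free N' M\<^esub>
               frag_extend (\<lambda>(x, y). frag_of (f x, y)) u)"

text \<open>HOL cannot quantify over the carrier type of the test modules. The type chosen here contains
  a copy of every quotient of \<open>A ^ n\<close> for every natural number \<open>n\<close>, hence of every finitely
  generated \<open>A\<close>-module. As tensor products commute with direct limits and direct limits of
  injective maps are injective, this is the same as testing with all \<open>A\<close>-modules.\<close>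

definition pure_hom ::
  "('a, 'c) ring_scheme \<Rightarrow> ('b, 'd) ring_scheme \<Rightarrow> ('a \<Rightarrow> 'b) \<Rightarrow> bool" where
  "pure_hom A B h \<longleftrightarrow>
     h \<in> ring_hom A B \<and>
     (\<forall>M :: ('a, (nat \<Rightarrow> 'a) set) module. module A M \<longrightarrow>
        inj_on (tensor_map A (module_via h B) M h)
          (carrier (tensor_product A (module_via id A) M)))"

definition F_pure :: "nat \<Rightarrow> ('a, 'c) ring_scheme \<Rightarrow> bool" where
  "F_pure p R \<longleftrightarrow> pure_hom R R (\<lambda>a. a [^]\<^bsub>R\<^esub> p)"


section \<open>Integral closure\<close>

definition integral_over :: "('a, 'c) ring_scheme \<Rightarrow> 'a set \<Rightarrow> 'a \<Rightarrow> bool" where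
  "integral_over B K b \<longleftrightarrow>
     (\<exists>f \<in> carrier (K[X]\<^bsub>B\<^esub>). f \<noteq> [] \<and> lead_coeff f = \<one>\<^bsub>B\<^esub> \<and> ring.eval B f b = \<zero>\<^bsub>B\<^esub>)"

definition integral_closure :: "('a, 'c) ring_scheme \<Rightarrow> ('a \<times> 'a) set set" where
  "integral_closure R =
     {b \<in> carrier (total_quotient_ring R).
        integral_over (total_quotient_ring R) (quot_embed R ` carrier R) b}"

definition finitely_generated_module :: "('a, 'c) ring_scheme \<Rightarrow> ('a, 'm) module \<Rightarrow> bool" where
  "finitely_generated_module A M \<longleftrightarrow>
     (\<exists>U. finite U \<and> U \<subseteq> carrier M \<and> (\<forall>H. submodule H A M \<and> U \<subseteq> H \<longrightarrow> H = carrier M))"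

definition Mori :: "('a, 'c) ring_scheme \<Rightarrow> bool" where
  "Mori R \<longleftrightarrow>
     reduced_ring R \<and>
     finitely_generated_module R
       (module_via (quot_embed R) (total_quotient_ring R \<lparr>carrier := integral_closure R\<rparr>))"


section \<open>Weak normality\<close>

definition fraction_field :: "('a, 'c) ring_scheme \<Rightarrow> ('a \<times> 'a) set ring" where
  "fraction_field D = localization D (carrier D - {\<zero>\<^bsub>D\<^esub>})"

definition residue_field :: "('a, 'c) ring_scheme \<Rightarrow> 'a set \<Rightarrow> ('a set \<times> 'a set) set ring" where
  "residue_field A P = fraction_field (A Quot P)"

definition contraction :: "('a, 'c) ring_scheme \<Rightarrow> ('a \<Rightarrow> 'b) \<Rightarrow> 'b set \<Rightarrow> 'a set" where
  "contraction A i P = {a \<in> carrier A. i a \<in> P}"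

text \<open>The map from the residue field of \<open>A\<close> at the contraction of \<open>P\<close> to the residue field of
  \<open>B\<close> at \<open>P\<close>: the inner union is the induced map of quotient rings.\<close>

definition residue_map ::
  "('b, 'd) ring_scheme \<Rightarrow> ('a \<Rightarrow> 'b) \<Rightarrow> 'b set \<Rightarrow>
     ('a set \<times> 'a set) set \<Rightarrow> ('b set \<times> 'b set) set" where
  "residue_map B i P =
     localization_map (B Quot P) (carrier (B Quot P) - {\<zero>\<^bsub>B Quot P\<^esub>})
       (\<lambda>U. \<Union>a\<in>U. P +>\<^bsub>B\<^esub> i a)"

definition exponential_char :: "('a, 'c) ring_scheme \<Rightarrow> nat" where
  "exponential_char K = (if ring_char K = 0 then 1 else ring_char K)"

definition purely_inseparable ::
  "('a, 'c) ring_scheme \<Rightarrow> ('b, 'd) ring_scheme \<Rightarrow> ('a \<Rightarrow> 'b) \<Rightarrow> bool" where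
  "purely_inseparable K L f \<longleftrightarrow>
     (\<forall>x \<in> carrier L. \<exists>n::nat. x [^]\<^bsub>L\<^esub> (exponential_char K ^ n) \<in> f ` carrier K)"

definition weakly_subintegral ::
  "('a, 'c) ring_scheme \<Rightarrow> ('b, 'd) ring_scheme \<Rightarrow> ('a \<Rightarrow> 'b) \<Rightarrow> bool" where
  "weakly_subintegral A B i \<longleftrightarrow>
     i \<in> ring_hom A B \<and> inj_on i (carrier A) \<and>
     (\<forall>b \<in> carrier B. integral_over B (i ` carrier A) b) \<and>
     bij_betw (contraction A i) (Spec B) (Spec A) \<and>
     (\<forall>P \<in> Spec B.
        purely_inseparable (residue_field A (contraction A i P)) (residue_field B P)
          (residue_map B i P))"

definition weakly_subintegral_subextensions :: "('a, 'c) ring_scheme \<Rightarrow> ('a \<times> 'a) set set set" where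
  "weakly_subintegral_subextensions R =
     {B. subring B (total_quotient_ring R) \<and>
         quot_embed R ` carrier R \<subseteq> B \<and> B \<subseteq> integral_closure R \<and>
         weakly_subintegral R (total_quotient_ring R \<lparr>carrier := B\<rparr>) (quot_embed R)}"

definition is_weak_normalization :: "('a, 'c) ring_scheme \<Rightarrow> ('a \<times> 'a) set set \<Rightarrow> bool" where
  "is_weak_normalization R C \<longleftrightarrow>
     C \<in> weakly_subintegral_subextensions R \<and>
     (\<forall>B \<in> weakly_subintegral_subextensions R. B \<subseteq> C)"

definition weakly_normal :: "('a, 'c) ring_scheme \<Rightarrow> bool" where
  "weakly_normal R \<longleftrightarrow> is_weak_normalization R (quot_embed R ` carrier R)"


section \<open>Weakly Arf rings\<close>

definition weakly_Arf :: "('a, 'c) ring_scheme \<Rightarrow> bool" where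
  "weakly_Arf R \<longleftrightarrow>
     (\<forall>x \<in> nonzerodivisors R. \<forall>y \<in> carrier R. \<forall>z \<in> carrier R.
        quot_elem R y x \<in> integral_closure R \<and> quot_elem R z x \<in> integral_closure R \<longrightarrow>
        quot_elem R (y \<otimes>\<^bsub>R\<^esub> z) x \<in> quot_embed R ` carrier R)"

end

theory Submission
  imports Defs
begin

text \<open>
  Let \<open>u = y z / x\<close> with \<open>y / x\<close> and \<open>z / x\<close> integral over \<open>R\<close>. An integral fraction with denominator
  \<open>x\<close> has a single power of \<open>x\<close> as denominator for all its powers
  (\<open>integral_common_denominator\<close>). Writing \<open>u = x (y / x) (z / x)\<close>, one sees that the
  factor \<open>x\<^sup>q\<close> of \<open>u\<^sup>q\<close> clears the denominators of the other two factors when \<open>q\<close> is large, so \<open>u\<^sup>q\<close>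
  lies in \<open>R\<close> for all large \<open>q\<close> (\<open>product_power_in_R\<close>), in particular for some \<open>q = p\<^sup>e\<close>. It remains
  to extract \<open>p\<close>-power roots inside the total quotient ring.

  If \<open>R\<close> is \<open>F\<close>-pure, the Frobenius map contracts principal ideals
  (\<open>pure_hom_contract_principal\<close>): \<open>s\<^sup>p \<in> x\<^sup>p R\<close> implies \<open>s \<in> x R\<close>. This says that a fraction whose
  \<open>p\<close>-th power is in \<open>R\<close> is itself in \<open>R\<close> (\<open>F_pure_root\<close>).

  If \<open>R\<close> is weakly normal, consider the ring \<open>B\<close> of all fractions with some \<open>p\<close>-power in \<open>R\<close>. Each
  prime of \<open>R\<close> has exactly one prime of \<open>B\<close> above it, made of the elements with some \<open>p\<close>-power in that
  prime, and residue fields grow only by \<open>p\<close>-power roots. So \<open>B\<close> is weakly subintegral over \<open>R\<close>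
  (\<open>p_radical_imp_weakly_subintegral\<close>) and equals \<open>R\<close> (\<open>weakly_normal_root\<close>).
\<close>

section \<open>Rings of fractions\<close>

locale fractions = cring R for R (structure) +
  fixes S
  assumes denom_carrier: "S \<subseteq> carrier R"
    and one_denom: "\<one> \<in> S"
    and denom_mult: "s \<in> S \<Longrightarrow> t \<in> S \<Longrightarrow> s \<otimes> t \<in> S"
begin

lemma denom_closed [simp]: "s \<in> S \<Longrightarrow> s \<in> carrier R"
  using denom_carrier by blast

lemma frac_rel_iff:
  "((a, s), (b, t)) \<in> frac_rel R S \<longleftrightarrow>
     a \<in> carrier R \<and> s \<in> S \<and> b \<in> carrier R \<and> t \<in> S \<and>
     (\<exists>u \<in> S. u \<otimes> (t \<otimes> a) = u \<otimes> (s \<otimes> b))"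
proof -
  have "u \<otimes> (t \<otimes> a \<ominus> s \<otimes> b) = \<zero> \<longleftrightarrow> u \<otimes> (t \<otimes> a) = u \<otimes> (s \<otimes> b)"
    if "a \<in> carrier R" "s \<in> S" "b \<in> carrier R" "t \<in> S" "u \<in> S" for u
  proof -
    have "u \<otimes> (t \<otimes> a \<ominus> s \<otimes> b) = u \<otimes> (t \<otimes> a) \<ominus> u \<otimes> (s \<otimes> b)"
      using that by (simp add: a_minus_def r_distr r_minus)
    then show ?thesis using that by (simp add: r_right_minus_eq)
  qed
  then show ?thesis unfolding frac_rel_def by auto
qed

text \<open>The witness has to absorb the middle denominator \<open>t\<close>, which may be a zerodivisor: this is where
  closure of the denominators under multiplication enters.\<close>

lemma frac_rel_trans:
  assumes "((a, s), (b, t)) \<in> frac_rel R S" and "((b, t), (c, r)) \<in> frac_rel R S"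
  shows "((a, s), (c, r)) \<in> frac_rel R S"
proof -
  obtain u v where c: "a \<in> carrier R" "b \<in> carrier R" "c \<in> carrier R"
      "s \<in> S" "t \<in> S" "r \<in> S" "u \<in> S" "v \<in> S"
    and u: "u \<otimes> (t \<otimes> a) = u \<otimes> (s \<otimes> b)" and v: "v \<otimes> (r \<otimes> b) = v \<otimes> (t \<otimes> c)"
    using assms by (auto simp: frac_rel_iff)
  have "(u \<otimes> v \<otimes> t) \<otimes> (r \<otimes> a) = (v \<otimes> r) \<otimes> (u \<otimes> (t \<otimes> a))"
    using c by (simp add: m_ac)
  also have "\<dots> = (u \<otimes> s) \<otimes> (v \<otimes> (r \<otimes> b))"
    unfolding u using c by (simp add: m_ac)
  also have "\<dots> = (u \<otimes> v \<otimes> t) \<otimes> (s \<otimes> c)"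
    unfolding v using c by (simp add: m_ac)
  finally show ?thesis
    using c by (auto simp: frac_rel_iff intro!: bexI[of _ "u \<otimes> v \<otimes> t"] denom_mult)
qed

lemma equiv_frac_rel: "equiv (carrier R \<times> S) (frac_rel R S)"
proof (rule equivI)
  show "refl_on (carrier R \<times> S) (frac_rel R S)"
    using one_denom by (auto simp: refl_on_def frac_rel_iff)
  show "sym (frac_rel R S)"
    by (rule symI) (auto simp: frac_rel_iff, metis)
  show "trans (frac_rel R S)"
    by (rule transI) (use frac_rel_trans in auto)
  show "frac_rel R S \<subseteq> (carrier R \<times> S) \<times> carrier R \<times> S"
    by (auto simp: frac_rel_iff)
qed

lemma mk_frac_eq_iff:
  assumes "a \<in> carrier R" "s \<in> S" "b \<in> carrier R" "t \<in> S"
  shows "mk_frac R S a s = mk_frac R S b t \<longleftrightarrow> (\<exists>u \<in> S. u \<otimes> (t \<otimes> a) = u \<otimes> (s \<otimes> b))"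
  unfolding mk_frac_def using assms
  by (subst eq_equiv_class_iff[OF equiv_frac_rel]) (auto simp: frac_rel_iff)

lemma mk_frac_eqI:
  assumes "a \<in> carrier R" "s \<in> S" "b \<in> carrier R" "t \<in> S" "t \<otimes> a = s \<otimes> b"
  shows "mk_frac R S a s = mk_frac R S b t"
  using assms one_denom by (auto simp: mk_frac_eq_iff)

lemma mk_frac_closed [simp]:
  "a \<in> carrier R \<Longrightarrow> s \<in> S \<Longrightarrow> mk_frac R S a s \<in> carrier (localization R S)"
  unfolding localization_def mk_frac_def by (auto intro: quotientI)

lemma localization_cases:
  assumes "U \<in> carrier (localization R S)"
  obtains a s where "a \<in> carrier R" "s \<in> S" "U = mk_frac R S a s"
  using assms unfolding localization_def mk_frac_def by (auto elim!: quotientE)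

text \<open>The ring operations on fractions are unions over all pairs of representatives; by this lemma
  such a union can be computed from any one pair.\<close>

lemma UN_mk_frac2:
  assumes f: "\<And>a s b t a' s' b' t'. ((a, s), (a', s')) \<in> frac_rel R S \<Longrightarrow>
      ((b, t), (b', t')) \<in> frac_rel R S \<Longrightarrow> f a s b t = f a' s' b' t'"
    and c: "a \<in> carrier R" "s \<in> S" "b \<in> carrier R" "t \<in> S"
  shows "(\<Union>(a, s)\<in>mk_frac R S a s. \<Union>(b, t)\<in>mk_frac R S b t. f a s b t) = f a s b t"
proof -
  have "congruent2 (frac_rel R S) (frac_rel R S) (\<lambda>(a, s) (b, t). f a s b t)"
    by (rule congruent2I') (use f in auto)
  from UN_equiv_class2[OF equiv_frac_rel equiv_frac_rel this, of "(a, s)" "(b, t)"] c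
  show ?thesis unfolding mk_frac_def by (simp add: case_prod_unfold)
qed

lemma mult_mk_frac [simp]:
  assumes "a \<in> carrier R" "s \<in> S" "b \<in> carrier R" "t \<in> S"
  shows "mk_frac R S a s \<otimes>\<^bsub>localization R S\<^esub> mk_frac R S b t = mk_frac R S (a \<otimes> b) (s \<otimes> t)"
proof -
  have "mk_frac R S (a \<otimes> b) (s \<otimes> t) = mk_frac R S (a' \<otimes> b') (s' \<otimes> t')"
    if A: "((a, s), (a', s')) \<in> frac_rel R S" "((b, t), (b', t')) \<in> frac_rel R S"
    for a s b t a' s' b' t'
  proof -
    obtain u v where c: "a \<in> carrier R" "b \<in> carrier R" "a' \<in> carrier R" "b' \<in> carrier R"
        "s \<in> S" "t \<in> S" "s' \<in> S" "t' \<in> S" "u \<in> S" "v \<in> S"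
      and u: "u \<otimes> (s' \<otimes> a) = u \<otimes> (s \<otimes> a')" and v: "v \<otimes> (t' \<otimes> b) = v \<otimes> (t \<otimes> b')"
      using A by (auto simp: frac_rel_iff)
    have "(u \<otimes> v) \<otimes> ((s' \<otimes> t') \<otimes> (a \<otimes> b)) = (u \<otimes> (s' \<otimes> a)) \<otimes> (v \<otimes> (t' \<otimes> b))"
      using c by (simp add: m_ac)
    also have "\<dots> = (u \<otimes> v) \<otimes> ((s \<otimes> t) \<otimes> (a' \<otimes> b'))"
      unfolding u v using c by (simp add: m_ac)
    finally show ?thesis
      using c denom_mult by (subst mk_frac_eq_iff) (auto intro!: bexI[of _ "u \<otimes> v"])
  qed
  from UN_mk_frac2[of "\<lambda>a s b t. mk_frac R S (a \<otimes> b) (s \<otimes> t)", OF this assms]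
  show ?thesis unfolding localization_def by simp
qed

lemma add_mk_frac [simp]:
  assumes "a \<in> carrier R" "s \<in> S" "b \<in> carrier R" "t \<in> S"
  shows "mk_frac R S a s \<oplus>\<^bsub>localization R S\<^esub> mk_frac R S b t =
    mk_frac R S (t \<otimes> a \<oplus> s \<otimes> b) (s \<otimes> t)"
proof -
  have "mk_frac R S (t \<otimes> a \<oplus> s \<otimes> b) (s \<otimes> t) = mk_frac R S (t' \<otimes> a' \<oplus> s' \<otimes> b') (s' \<otimes> t')"
    if A: "((a, s), (a', s')) \<in> frac_rel R S" "((b, t), (b', t')) \<in> frac_rel R S"
    for a s b t a' s' b' t'
  proof -
    obtain u v where c: "a \<in> carrier R" "b \<in> carrier R" "a' \<in> carrier R" "b' \<in> carrier R"
        "s \<in> S" "t \<in> S" "s' \<in> S" "t' \<in> S" "u \<in> S" "v \<in> S"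
      and u: "u \<otimes> (s' \<otimes> a) = u \<otimes> (s \<otimes> a')" and v: "v \<otimes> (t' \<otimes> b) = v \<otimes> (t \<otimes> b')"
      using A by (auto simp: frac_rel_iff)
    have "(u \<otimes> v) \<otimes> ((s' \<otimes> t') \<otimes> (t \<otimes> a \<oplus> s \<otimes> b)) =
        (v \<otimes> t \<otimes> t') \<otimes> (u \<otimes> (s' \<otimes> a)) \<oplus> (u \<otimes> s \<otimes> s') \<otimes> (v \<otimes> (t' \<otimes> b))"
      using c by (simp add: m_ac r_distr)
    also have "\<dots> = (u \<otimes> v) \<otimes> ((s \<otimes> t) \<otimes> (t' \<otimes> a' \<oplus> s' \<otimes> b'))"
      unfolding u v using c by (simp add: m_ac r_distr)
    finally show ?thesis
      using c denom_mult by (subst mk_frac_eq_iff) (auto intro!: bexI[of _ "u \<otimes> v"])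
  qed
  from UN_mk_frac2[of "\<lambda>a s b t. mk_frac R S (t \<otimes> a \<oplus> s \<otimes> b) (s \<otimes> t)", OF this assms]
  show ?thesis unfolding localization_def by simp
qed

lemma one_localization: "\<one>\<^bsub>localization R S\<^esub> = mk_frac R S \<one> \<one>"
  and zero_localization: "\<zero>\<^bsub>localization R S\<^esub> = mk_frac R S \<zero> \<one>"
  by (simp_all add: localization_def)

lemma localization_cring: "cring (localization R S)"
proof (rule cringI)
  note [simp] = one_localization zero_localization one_denom denom_mult
  show "abelian_group (localization R S)"
  proof (rule abelian_groupI, goal_cases)
    case (1 U V)
    then show ?case by (elim localization_cases) simp
  next
    case 2 then show ?case by simp
  next
    case (3 U V W)
    then show ?case
      by (elim localization_cases) (simp, intro mk_frac_eqI; simp add: m_ac r_distr a_ac)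
  next
    case (4 U V)
    then show ?case
      by (elim localization_cases) (simp, intro mk_frac_eqI; simp add: m_ac r_distr a_ac)
  next
    case (5 U)
    then show ?case
      by (elim localization_cases) (simp)
  next
    case (6 U)
    then obtain a s where a: "a \<in> carrier R" "s \<in> S" "U = mk_frac R S a s"
      by (rule localization_cases)
    have "mk_frac R S (\<ominus> a) s \<oplus>\<^bsub>localization R S\<^esub> U = mk_frac R S \<zero> (s \<otimes> s)"
      using a by (simp add: r_minus l_neg)
    also have "\<dots> = \<zero>\<^bsub>localization R S\<^esub>"
      using a by (simp, intro mk_frac_eqI) simp_all
    finally show ?case
      using a by (intro bexI[of _ "mk_frac R S (\<ominus> a) s"]) simp_all
  qed
  show "Group.comm_monoid (localization R S)"
  proof (rule comm_monoidI, goal_cases)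
    case (1 U V)
    then show ?case by (elim localization_cases) simp
  next
    case 2 then show ?case by simp
  next
    case (3 U V W)
    then show ?case by (elim localization_cases) (simp add: m_ac)
  next
    case (4 U)
    then show ?case by (elim localization_cases) (simp)
  next
    case (5 U V)
    then show ?case by (elim localization_cases) (simp add: m_ac)
  qed
  show "(U \<oplus>\<^bsub>localization R S\<^esub> V) \<otimes>\<^bsub>localization R S\<^esub> W =
      U \<otimes>\<^bsub>localization R S\<^esub> W \<oplus>\<^bsub>localization R S\<^esub> V \<otimes>\<^bsub>localization R S\<^esub> W"
    if "U \<in> carrier (localization R S)" "V \<in> carrier (localization R S)"
       "W \<in> carrier (localization R S)" for U V W
    using that
    by (elim localization_cases) (simp, intro mk_frac_eqI; simp add: m_ac r_distr a_ac)
qed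

lemma mk_frac_pow:
  assumes "a \<in> carrier R" "s \<in> S"
  shows "s [^] (n::nat) \<in> S"
    and "mk_frac R S a s [^]\<^bsub>localization R S\<^esub> n = mk_frac R S (a [^] n) (s [^] n)"
proof -
  interpret L: cring "localization R S" by (rule localization_cring)
  show s: "s [^] n \<in> S" for n :: nat
    using assms by (induction n) (auto intro: one_denom denom_mult)
  show "mk_frac R S a s [^]\<^bsub>localization R S\<^esub> n = mk_frac R S (a [^] n) (s [^] n)"
    using assms by (induction n) (simp_all add: one_localization s)
qed

lemma frac_hom: "(\<lambda>a. mk_frac R S a \<one>) \<in> ring_hom R (localization R S)"
  by (rule ring_hom_memI) (simp_all add: one_denom one_localization)

end


section \<open>Purity\<close>

lemma module_via_module:
  assumes "cring A" "cring B" "h \<in> ring_hom A B"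
  shows "module A (module_via h B)"
proof -
  interpret A: cring A by fact
  interpret B: cring B by fact
  interpret h: ring_hom_cring A B h
    by (rule ring_hom_cringI) (use assms in \<open>auto simp: cring_def\<close>)
  show ?thesis
  proof (rule moduleI)
    show "abelian_group (module_via h B)"
    proof (rule abelian_groupI)
      fix x assume "x \<in> carrier (module_via h B)"
      then show "\<exists>y \<in> carrier (module_via h B). y \<oplus>\<^bsub>module_via h B\<^esub> x = \<zero>\<^bsub>module_via h B\<^esub>"
        by (intro bexI[of _ "\<ominus>\<^bsub>B\<^esub> x"]) (simp_all add: module_via_def B.l_neg)
    qed (simp_all add: module_via_def B.a_ac)
  qed (simp_all add: module_via_def A.is_cring B.l_distr B.r_distr B.m_assoc)
qed

text \<open>Purity can only be tested on modules whose elements have one particular type, so a test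
  module found elsewhere has to be moved to that type along an injection.\<close>

lemma module_transport:
  fixes M :: "('a, 'm) module" and A (structure)
  assumes "module A M" and k: "\<And>x. x \<in> carrier M \<Longrightarrow> k (j x) = x"
  shows "module A \<lparr>carrier = j ` carrier M, monoid.mult = undefined, one = undefined,
     ring.zero = j \<zero>\<^bsub>M\<^esub>, add = (\<lambda>u v. j (k u \<oplus>\<^bsub>M\<^esub> k v)), smult = (\<lambda>a u. j (a \<odot>\<^bsub>M\<^esub> k u))\<rparr>"
    (is "module A ?N")
proof -
  interpret module A M by fact
  show ?thesis
  proof (rule moduleI)
    show "abelian_group ?N"
    proof (rule abelian_groupI)
      fix u assume "u \<in> carrier ?N"
      then obtain x where "x \<in> carrier M" "u = j x" by auto
      then show "\<exists>v \<in> carrier ?N. v \<oplus>\<^bsub>?N\<^esub> u = \<zero>\<^bsub>?N\<^esub>"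
        by (intro bexI[of _ "j (\<ominus>\<^bsub>M\<^esub> x)"]) (auto simp: k M.l_neg)
    qed (auto simp: k M.a_ac)
  qed (auto simp: k is_cring smult_l_distr smult_r_distr smult_assoc1)
qed

lemma tensor_rels_subgroup:
  assumes "module A N" "module A M"
  shows "subgroup (tensor_rels A N M) (tensor_free N M)"
proof -
  interpret N: module A N by fact
  interpret M: module A M by fact
  interpret F: group "tensor_free N M" by (simp add: tensor_free_def)
  have diff: "u - v \<in> carrier (tensor_free N M)"
    if "u \<in> carrier (tensor_free N M)" "v \<in> carrier (tensor_free N M)" for u v
    using that keys_diff[of u v] unfolding tensor_free_def by auto
  have frag: "frag_of (x, y) \<in> carrier (tensor_free N M)"
    if "x \<in> carrier N" "y \<in> carrier M" for x y
    using that unfolding tensor_free_def by simp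
  show ?thesis
    unfolding tensor_rels_def by (rule F.generate_is_subgroup) (auto intro!: diff frag)
qed

lemma tensor_rels_arith:
  assumes "module A N" "module A M"
  shows "0 \<in> tensor_rels A N M"
    and "u \<in> tensor_rels A N M \<Longrightarrow> v \<in> tensor_rels A N M \<Longrightarrow> u + v \<in> tensor_rels A N M"
    and "u \<in> tensor_rels A N M \<Longrightarrow> - u \<in> tensor_rels A N M"
    and "u \<in> tensor_rels A N M \<Longrightarrow> v \<in> tensor_rels A N M \<Longrightarrow> u - v \<in> tensor_rels A N M"
proof -
  interpret subgroup "tensor_rels A N M" "tensor_free N M"
    by (rule tensor_rels_subgroup) fact+
  show "0 \<in> tensor_rels A N M"
    using one_closed unfolding tensor_free_def by simp
  show plus: "u + v \<in> tensor_rels A N M" if "u \<in> tensor_rels A N M" "v \<in> tensor_rels A N M" for u v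
    using m_closed[OF that] unfolding tensor_free_def by simp
  show minus: "- u \<in> tensor_rels A N M" if "u \<in> tensor_rels A N M" for u
  proof -
    have "u \<in> carrier (tensor_free N M)" using subset that by (rule subsetD)
    then have "inv\<^bsub>tensor_free N M\<^esub> u = - u" by (simp add: tensor_free_def)
    then show ?thesis using m_inv_closed[OF that] by simp
  qed
  show "u - v \<in> tensor_rels A N M" if "u \<in> tensor_rels A N M" "v \<in> tensor_rels A N M"
    unfolding diff_conv_add_uminus by (rule plus[OF that(1) minus[OF that(2)]])
qed

lemma tensor_rcoset:
  "tensor_rels A N M #>\<^bsub>tensor_free N M\<^esub> w = (\<lambda>u. u + w) ` tensor_rels A N M"
  by (auto simp: r_coset_def tensor_free_def)

text \<open>The elements of a tensor product are cosets of the relations, so two formal sums name the same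
  tensor as soon as their difference is a relation.\<close>

lemma tensor_rcoset_eqI:
  assumes "module A N" "module A M" "u - v \<in> tensor_rels A N M"
  shows "tensor_rels A N M #>\<^bsub>tensor_free N M\<^esub> u = tensor_rels A N M #>\<^bsub>tensor_free N M\<^esub> v"
proof -
  note arith = tensor_rels_arith[OF assms(1,2)]
  have "r + u \<in> (\<lambda>r. r + v) ` tensor_rels A N M" if "r \<in> tensor_rels A N M" for r
    using arith(2)[OF that assms(3)] by (intro image_eqI[of _ _ "r + (u - v)"]) simp_all
  moreover have "r + v \<in> (\<lambda>r. r + u) ` tensor_rels A N M" if "r \<in> tensor_rels A N M" for r
    using arith(4)[OF that assms(3)] by (intro image_eqI[of _ _ "r - (u - v)"]) simp_all
  ultimately show ?thesis unfolding tensor_rcoset by blast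
qed

lemma tensor_rels_bilinear:
  shows "x \<in> carrier N \<Longrightarrow> x' \<in> carrier N \<Longrightarrow> y \<in> carrier M \<Longrightarrow>
      frag_of (x \<oplus>\<^bsub>N\<^esub> x', y) - frag_of (x, y) - frag_of (x', y) \<in> tensor_rels A N M"
    and "x \<in> carrier N \<Longrightarrow> y \<in> carrier M \<Longrightarrow> y' \<in> carrier M \<Longrightarrow>
      frag_of (x, y \<oplus>\<^bsub>M\<^esub> y') - frag_of (x, y) - frag_of (x, y') \<in> tensor_rels A N M"
    and "a \<in> carrier A \<Longrightarrow> x \<in> carrier N \<Longrightarrow> y \<in> carrier M \<Longrightarrow>
      frag_of (a \<odot>\<^bsub>N\<^esub> x, y) - frag_of (x, a \<odot>\<^bsub>M\<^esub> y) \<in> tensor_rels A N M"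
  unfolding tensor_rels_def by (rule generate.incl, blast)+

text \<open>The universal property of the tensor product, in the form of a rule for showing that something
  holds for all relations.\<close>

lemma tensor_rels_in_subgroup:
  assumes "module A N" "module A M" "subgroup H (tensor_free N M)"
    and "\<And>x x' y. x \<in> carrier N \<Longrightarrow> x' \<in> carrier N \<Longrightarrow> y \<in> carrier M \<Longrightarrow>
      frag_of (x \<oplus>\<^bsub>N\<^esub> x', y) - frag_of (x, y) - frag_of (x', y) \<in> H"
    and "\<And>x y y'. x \<in> carrier N \<Longrightarrow> y \<in> carrier M \<Longrightarrow> y' \<in> carrier M \<Longrightarrow>
      frag_of (x, y \<oplus>\<^bsub>M\<^esub> y') - frag_of (x, y) - frag_of (x, y') \<in> H"
    and "\<And>a x y. a \<in> carrier A \<Longrightarrow> x \<in> carrier N \<Longrightarrow> y \<in> carrier M \<Longrightarrow>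
      frag_of (a \<odot>\<^bsub>N\<^esub> x, y) - frag_of (x, a \<odot>\<^bsub>M\<^esub> y) \<in> H"
  shows "tensor_rels A N M \<subseteq> H"
proof -
  interpret F: group "tensor_free N M" by (simp add: tensor_free_def)
  show ?thesis
    unfolding tensor_rels_def
    by (rule F.generate_subgroup_incl[OF _ assms(3)]) (auto intro: assms(4-6))
qed

text \<open>This detects nonzero elements of \<open>A \<otimes> M\<close>: the action \<open>a \<otimes> m \<mapsto> a m\<close> is bilinear, hence induces a
  homomorphism into \<open>M\<close> that kills all the relations.\<close>

lemma tensor_rels_action:
  assumes "module A M" "a \<in> carrier A" "m \<in> carrier M"
    and "frag_of (a, m) \<in> tensor_rels A (module_via id A) M"
  shows "a \<odot>\<^bsub>M\<^esub> m = \<zero>\<^bsub>M\<^esub>"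
proof -
  interpret M: module A M by fact
  let ?N = "module_via id A"
  have N: "module A ?N"
    by (rule module_via_module) (auto simp: M.is_cring ring_hom_def)
  interpret F: group "tensor_free ?N M" by (simp add: tensor_free_def)
  have car: "carrier ?N = carrier A" "add ?N = add A" "smult ?N = monoid.mult A"
    by (auto simp: module_via_def)
  define \<phi>0 where "\<phi>0 = (\<lambda>(x, y). x \<odot>\<^bsub>M\<^esub> y)"
  obtain \<phi> where hom: "\<phi> \<in> hom (tensor_free ?N M) (add_monoid M)"
    and \<phi>: "\<And>z. z \<in> carrier ?N \<times> carrier M \<Longrightarrow> \<phi> (frag_of z) = \<phi>0 z"
    by (rule comm_group.free_Abelian_group_universal
        [OF M.a_comm_group, of \<phi>0 "carrier ?N \<times> carrier M"])
      (auto simp: \<phi>0_def car tensor_free_def)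
  interpret \<phi>: group_hom "tensor_free ?N M" "add_monoid M" \<phi>
    by (intro group_hom.intro group_hom_axioms.intro hom M.a_group F.is_group)
  have \<phi>_diff: "\<phi> (u - v) = \<phi> u \<ominus>\<^bsub>M\<^esub> \<phi> v"
    if "u \<in> carrier (tensor_free ?N M)" "v \<in> carrier (tensor_free ?N M)" for u v
  proof -
    have inv: "inv\<^bsub>tensor_free ?N M\<^esub> v = - v"
      using that(2) unfolding tensor_free_def by simp
    have "\<phi> (u - v) = \<phi> (u \<otimes>\<^bsub>tensor_free ?N M\<^esub> inv\<^bsub>tensor_free ?N M\<^esub> v)"
      unfolding inv by (simp add: tensor_free_def)
    also have "\<dots> = \<phi> u \<ominus>\<^bsub>M\<^esub> \<phi> v"
      using that \<phi>.hom_mult \<phi>.hom_inv by (simp add: a_minus_def a_inv_def)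
    finally show ?thesis .
  qed
  have diff: "u - v \<in> carrier (tensor_free ?N M)"
    if "u \<in> carrier (tensor_free ?N M)" "v \<in> carrier (tensor_free ?N M)" for u v
    using that keys_diff[of u v] unfolding tensor_free_def by auto
  have frag: "frag_of (x, y) \<in> carrier (tensor_free ?N M)"
    if "x \<in> carrier A" "y \<in> carrier M" for x y
    using that unfolding tensor_free_def by (simp add: car)
  have val: "\<phi> (frag_of (x, y)) = x \<odot>\<^bsub>M\<^esub> y" if "x \<in> carrier A" "y \<in> carrier M" for x y
    using that \<phi>[of "(x, y)"] by (simp add: car \<phi>0_def)
  have cancel: "(u \<oplus>\<^bsub>M\<^esub> v) \<ominus>\<^bsub>M\<^esub> u \<ominus>\<^bsub>M\<^esub> v = \<zero>\<^bsub>M\<^esub>"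
    if "u \<in> carrier M" "v \<in> carrier M" for u v
  proof -
    have "(u \<oplus>\<^bsub>M\<^esub> v) \<ominus>\<^bsub>M\<^esub> u = v"
      using that by (simp add: M.minus_eq M.a_comm[of u v] M.a_assoc M.r_neg)
    then show ?thesis using that by (simp add: M.minus_eq M.r_neg)
  qed
  have "tensor_rels A ?N M \<subseteq> kernel (tensor_free ?N M) (add_monoid M) \<phi>"
  proof (rule tensor_rels_in_subgroup[OF N assms(1) \<phi>.subgroup_kernel], goal_cases)
    case (1 x x' y)
    then have "(x \<oplus>\<^bsub>A\<^esub> x') \<odot>\<^bsub>M\<^esub> y = x \<odot>\<^bsub>M\<^esub> y \<oplus>\<^bsub>M\<^esub> x' \<odot>\<^bsub>M\<^esub> y"
      by (simp add: car M.smult_l_distr)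
    with 1 show ?case by (simp add: kernel_def car \<phi>_diff diff frag val cancel)
  next
    case (2 x y y')
    then have "x \<odot>\<^bsub>M\<^esub> (y \<oplus>\<^bsub>M\<^esub> y') = x \<odot>\<^bsub>M\<^esub> y \<oplus>\<^bsub>M\<^esub> x \<odot>\<^bsub>M\<^esub> y'"
      by (simp add: car M.smult_r_distr)
    with 2 show ?case by (simp add: kernel_def car \<phi>_diff diff frag val cancel)
  next
    case (3 a x y)
    then have "(a \<otimes>\<^bsub>A\<^esub> x) \<odot>\<^bsub>M\<^esub> y = x \<odot>\<^bsub>M\<^esub> (a \<odot>\<^bsub>M\<^esub> y)"
      by (simp add: car M.smult_assoc1[symmetric] M.R.m_comm)
    with 3 show ?case
      by (simp add: kernel_def car \<phi>_diff diff frag val M.minus_eq M.r_neg)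
  qed
  with assms(4) have "\<phi> (frag_of (a, m)) = \<zero>\<^bsub>M\<^esub>"
    by (auto simp: kernel_def)
  then show ?thesis using val assms by simp
qed

text \<open>The map induced by \<open>f\<close> on formal sums preserves the relations because \<open>f\<close> is linear, so all
  representatives of a tensor have images in one coset.\<close>

lemma tensor_map_coset:
  fixes N :: "('a, 'n) module" and N' :: "('a, 'k) module" and M :: "('a, 'm) module"
  assumes N: "module A N" and N': "module A N'" and M: "module A M"
    and f: "\<And>x. x \<in> carrier N \<Longrightarrow> f x \<in> carrier N'"
      "\<And>x x'. x \<in> carrier N \<Longrightarrow> x' \<in> carrier N \<Longrightarrow> f (x \<oplus>\<^bsub>N\<^esub> x') = f x \<oplus>\<^bsub>N'\<^esub> f x'"
      "\<And>a x. a \<in> carrier A \<Longrightarrow> x \<in> carrier N \<Longrightarrow> f (a \<odot>\<^bsub>N\<^esub> x) = a \<odot>\<^bsub>N'\<^esub> f x"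
  shows "tensor_map A N' M f (tensor_rels A N M #>\<^bsub>tensor_free N M\<^esub> w) =
    tensor_rels A N' M #>\<^bsub>tensor_free N' M\<^esub> frag_extend (\<lambda>(x, y). frag_of (f x, y)) w"
proof -
  interpret N: module A N by fact
  interpret N': module A N' by fact
  interpret M: module A M by fact
  interpret F: group "tensor_free N M" by (simp add: tensor_free_def)
  interpret T: subgroup "tensor_rels A N M" "tensor_free N M"
    by (rule tensor_rels_subgroup) fact+
  define g where "g = frag_extend (\<lambda>(x, y). frag_of (f x, y :: 'm))"
  note arith = tensor_rels_arith[OF N M] and arith' = tensor_rels_arith[OF N' M]
  define H where "H = {u \<in> carrier (tensor_free N M). g u \<in> tensor_rels A N' M}"
  have "subgroup H (tensor_free N M)"
  proof (rule F.subgroupI)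
    show "H \<subseteq> carrier (tensor_free N M)" by (auto simp: H_def)
    have "0 \<in> H" using arith'(1) by (simp add: H_def g_def tensor_free_def)
    then show "H \<noteq> {}" by auto
    show "inv\<^bsub>tensor_free N M\<^esub> u \<in> H" if "u \<in> H" for u
    proof -
      have "inv\<^bsub>tensor_free N M\<^esub> u \<in> carrier (tensor_free N M)"
        using that by (auto simp: H_def)
      moreover have "inv\<^bsub>tensor_free N M\<^esub> u = - u"
        using that by (simp add: H_def tensor_free_def)
      ultimately show ?thesis using that arith'(3) by (simp add: H_def g_def frag_extend_minus)
    qed
    show "u \<otimes>\<^bsub>tensor_free N M\<^esub> v \<in> H" if "u \<in> H" "v \<in> H" for u v
    proof -
      have "u \<otimes>\<^bsub>tensor_free N M\<^esub> v \<in> carrier (tensor_free N M)"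
        using that by (auto simp: H_def)
      moreover have "u \<otimes>\<^bsub>tensor_free N M\<^esub> v = u + v" by (simp add: tensor_free_def)
      ultimately show ?thesis using that arith'(2) by (simp add: H_def g_def frag_extend_add)
    qed
  qed
  then have "tensor_rels A N M \<subseteq> H"
  proof (rule tensor_rels_in_subgroup[OF N M], goal_cases)
    case (1 x x' y)
    then show ?case using T.subset[THEN subsetD, OF tensor_rels_bilinear(1)[of x N x' y M A]]
        tensor_rels_bilinear(1)[of "f x" N' "f x'" y M A]
      by (auto simp: H_def g_def frag_extend_diff f)
  next
    case (2 x y y')
    then show ?case using T.subset[THEN subsetD, OF tensor_rels_bilinear(2)[of x N y M y' A]]
        tensor_rels_bilinear(2)[of "f x" N' y M y' A]
      by (auto simp: H_def g_def frag_extend_diff f)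
  next
    case (3 a x y)
    then show ?case using T.subset[THEN subsetD, OF tensor_rels_bilinear(3)[of a A x N y M]]
        tensor_rels_bilinear(3)[of a A "f x" N' y M]
      by (auto simp: H_def g_def frag_extend_diff f)
  qed
  then have g: "g u \<in> tensor_rels A N' M" if "u \<in> tensor_rels A N M" for u
    using that by (auto simp: H_def)
  have "tensor_rels A N' M #>\<^bsub>tensor_free N' M\<^esub> g (u + w) =
      tensor_rels A N' M #>\<^bsub>tensor_free N' M\<^esub> g w" if "u \<in> tensor_rels A N M" for u
    by (rule tensor_rcoset_eqI[OF N' M]) (use g[OF that] in \<open>simp add: g_def frag_extend_add\<close>)
  then have "(\<Union>u\<in>tensor_rels A N M #>\<^bsub>tensor_free N M\<^esub> w. tensor_rels A N' M #>\<^bsub>tensor_free N' M\<^esub> g u)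
     = tensor_rels A N' M #>\<^bsub>tensor_free N' M\<^esub> g w"
    using arith(1) unfolding tensor_rcoset[of N M A w] by blast
  then show ?thesis unfolding tensor_map_def g_def .
qed

text \<open>Pure extensions contract ideals: \<open>x B \<inter> A = x A\<close>. Tensor the extension with \<open>A / x A\<close>. If
  \<open>h s\<close> is a multiple of \<open>h x\<close>, then \<open>h s \<otimes> 1 = c \<otimes> x 1 = 0\<close>, so \<open>s \<otimes> 1 = 0\<close> by purity, and the
  action of \<open>A\<close> on \<open>A / x A\<close> turns this into \<open>s \<in> x A\<close>.\<close>

lemma pure_hom_contract_principal:
  fixes A :: "('a, 'c) ring_scheme" (structure)
  assumes "cring A" "cring B" and pure: "pure_hom A B h"
    and x: "x \<in> carrier A" and s: "s \<in> carrier A" and c: "c \<in> carrier B"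
    and eq: "h s = h x \<otimes>\<^bsub>B\<^esub> c"
  shows "\<exists>r \<in> carrier A. s = x \<otimes> r"
proof -
  interpret A: cring A by fact
  interpret B: cring B by fact
  have h: "h \<in> ring_hom A B" using pure by (simp add: pure_hom_def)
  define I where "I = PIdl x"
  interpret I: ideal I A unfolding I_def by (rule A.cgenideal_ideal[OF x])
  interpret Q: cring "A Quot I" by (rule I.quotient_is_cring[OF A.is_cring])
  let ?Q = "module_via ((+>) I) (A Quot I)"
  have Q: "module A ?Q"
    by (rule module_via_module[OF A.is_cring Q.is_cring I.rcos_ring_hom])
  \<comment> \<open>Cosets of the ideal become sets of constant sequences, which is the type of the test modules.\<close>
  define j where "j = (\<lambda>C. (\<lambda>a (n::nat). a) ` C :: (nat \<Rightarrow> 'a) set)"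
  define k where "k = (\<lambda>D. (\<lambda>f :: nat \<Rightarrow> 'a. f 0) ` D)"
  have kj: "k (j C) = C" for C by (auto simp: j_def k_def image_image)
  define M :: "('a, (nat \<Rightarrow> 'a) set) module" where "M = \<lparr>carrier = j ` carrier ?Q, monoid.mult = undefined, one = undefined,
     ring.zero = j \<zero>\<^bsub>?Q\<^esub>, add = (\<lambda>u v. j (k u \<oplus>\<^bsub>?Q\<^esub> k v)), smult = (\<lambda>a u. j (a \<odot>\<^bsub>?Q\<^esub> k u))\<rparr>"
  have M: "module A M"
    unfolding M_def by (rule module_transport[OF Q]) (rule kj)
  then interpret M: module A M .
  have car: "carrier ?Q = carrier (A Quot I)" by (simp add: module_via_def)
  define m where "m = j (I +> \<one>)"
  have m: "m \<in> carrier M"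
    using ring_hom_closed[OF I.rcos_ring_hom A.one_closed] unfolding m_def M_def car by simp
  have act: "a \<odot>\<^bsub>M\<^esub> m = j (I +> a)" if "a \<in> carrier A" for a
    using ring_hom_mult[OF I.rcos_ring_hom that A.one_closed, symmetric] that
    by (simp add: M_def m_def module_via_def kj)
  have zero: "a \<odot>\<^bsub>M\<^esub> m = \<zero>\<^bsub>M\<^esub> \<longleftrightarrow> a \<in> I" if "a \<in> carrier A" for a
  proof -
    have "\<zero>\<^bsub>M\<^esub> = j I" by (simp add: M_def module_via_def FactRing_def)
    then show ?thesis unfolding act[OF that]
      by (metis kj I.a_rcos_const I.a_rcos_self that)
  qed
  let ?N = "module_via id A" and ?N' = "module_via h B"
  have N: "module A ?N" by (rule module_via_module) (auto simp: A.is_cring ring_hom_def)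
  have N': "module A ?N'" by (rule module_via_module) (fact A.is_cring B.is_cring h)+
  let ?T = "tensor_rels A ?N M" and ?T' = "tensor_rels A ?N' M"
  note arith = tensor_rels_arith[OF N M] and arith' = tensor_rels_arith[OF N' M]
  have map: "tensor_map A ?N' M h (?T #>\<^bsub>tensor_free ?N M\<^esub> w) =
      ?T' #>\<^bsub>tensor_free ?N' M\<^esub> frag_extend (\<lambda>(x, y). frag_of (h x, y)) w" for w
    by (rule tensor_map_coset[OF N N' M])
      (use h in \<open>auto simp: module_via_def ring_hom_closed ring_hom_add ring_hom_mult\<close>)
  have hs: "frag_of (h s, m) \<in> ?T'"
  proof -
    have xm: "x \<odot>\<^bsub>M\<^esub> m = \<zero>\<^bsub>M\<^esub>" using zero[OF x] A.cgenideal_self[OF x] by (simp add: I_def)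
    have c': "c \<in> carrier ?N'" using c by (simp add: module_via_def)
    have "frag_of (x \<odot>\<^bsub>?N'\<^esub> c, m) - frag_of (c, x \<odot>\<^bsub>M\<^esub> m) \<in> ?T'"
      by (rule tensor_rels_bilinear(3)[OF x c' m])
    then have 1: "frag_of (h s, m) - frag_of (c, \<zero>\<^bsub>M\<^esub>) \<in> ?T'"
      unfolding xm by (simp add: module_via_def eq)
    \<comment> \<open>From c \<otimes> 0 = c \<otimes> (0 + 0) = c \<otimes> 0 + c \<otimes> 0.\<close>
    have "frag_of (c, \<zero>\<^bsub>M\<^esub> \<oplus>\<^bsub>M\<^esub> \<zero>\<^bsub>M\<^esub>) - frag_of (c, \<zero>\<^bsub>M\<^esub>) - frag_of (c, \<zero>\<^bsub>M\<^esub>) \<in> ?T'"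
      by (rule tensor_rels_bilinear(2)[OF c']) simp_all
    then have 2: "- frag_of (c, \<zero>\<^bsub>M\<^esub>) \<in> ?T'" by simp
    show ?thesis using arith'(4)[OF 1 2] by simp
  qed
  have in_carrier: "?T #>\<^bsub>tensor_free ?N M\<^esub> w \<in> carrier (tensor_product A ?N M)"
    if "w \<in> carrier (tensor_free ?N M)" for w
    using that unfolding tensor_product_def FactGroup_def RCOSETS_def by auto
  have fs: "frag_of (s, m) \<in> carrier (tensor_free ?N M)" "0 \<in> carrier (tensor_free ?N M)"
    using s m by (auto simp: tensor_free_def module_via_def)
  have "?T' #>\<^bsub>tensor_free ?N' M\<^esub> frag_of (h s, m) = ?T' #>\<^bsub>tensor_free ?N' M\<^esub> 0"
    by (rule tensor_rcoset_eqI[OF N' M]) (use hs in simp)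
  then have "tensor_map A ?N' M h (?T #>\<^bsub>tensor_free ?N M\<^esub> frag_of (s, m)) =
      tensor_map A ?N' M h (?T #>\<^bsub>tensor_free ?N M\<^esub> 0)"
    unfolding map by simp
  moreover have "inj_on (tensor_map A ?N' M h) (carrier (tensor_product A ?N M))"
    using pure M by (auto simp: pure_hom_def)
  ultimately have "?T #>\<^bsub>tensor_free ?N M\<^esub> frag_of (s, m) = ?T #>\<^bsub>tensor_free ?N M\<^esub> 0"
    using fs in_carrier by (auto dest: inj_onD)
  then have "frag_of (s, m) \<in> ?T"
    using arith(1) unfolding tensor_rcoset by force
  then have "s \<odot>\<^bsub>M\<^esub> m = \<zero>\<^bsub>M\<^esub>" by (rule tensor_rels_action[OF M s m])
  then have "s \<in> PIdl x" using zero[OF s] by (simp add: I_def)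
  then show ?thesis using x by (auto simp: cgenideal_def A.m_comm)
qed


section \<open>The Frobenius map in prime characteristic\<close>

context cring begin

lemma binomial_term_closed:
  assumes "a \<in> carrier R" "b \<in> carrier R"
  shows "(\<lambda>k. [(c k :: nat)] \<cdot> (a [^] (f k :: nat) \<otimes> b [^] (g k :: nat))) \<in> A \<rightarrow> carrier R"
  using assms by auto

lemma binomial:
  assumes a: "a \<in> carrier R" and b: "b \<in> carrier R"
  shows "(a \<oplus> b) [^] (n::nat) = (\<Oplus>k\<in>{..n}. [(n choose k)] \<cdot> (a [^] k \<otimes> b [^] (n - k)))"
proof (induction n)
  case 0
  then show ?case by simp
next
  case (Suc n)
  note closed = binomial_term_closed[OF a b]
  let ?S = "\<lambda>n. \<Oplus>k\<in>{..n}. [(n choose k)] \<cdot> (a [^] k \<otimes> b [^] (n - k))"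
  have S: "?S n \<in> carrier R" by (rule finsum_closed) (rule closed)
  have aS: "?S n \<otimes> a = (\<Oplus>k\<in>{..n}. [(n choose k)] \<cdot> (a [^] Suc k \<otimes> b [^] (n - k)))"
  proof -
    have "?S n \<otimes> a = (\<Oplus>k\<in>{..n}. [(n choose k)] \<cdot> (a [^] k \<otimes> b [^] (n - k)) \<otimes> a)"
      by (rule finsum_ldistr) (use a b in auto)
    also have "\<dots> = (\<Oplus>k\<in>{..n}. [(n choose k)] \<cdot> (a [^] Suc k \<otimes> b [^] (n - k)))"
      by (rule finsum_cong') (use a b in \<open>auto simp: add_pow_ldistr add_pow_rdistr m_ac\<close>)
    finally show ?thesis .
  qed
  have bS: "?S n \<otimes> b = b [^] Suc n \<oplus> (\<Oplus>k\<in>{..n}. [(n choose Suc k)] \<cdot> (a [^] Suc k \<otimes> b [^] (n - k)))"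
  proof -
    have "?S n \<otimes> b = (\<Oplus>k\<in>{..n}. [(n choose k)] \<cdot> (a [^] k \<otimes> b [^] (n - k)) \<otimes> b)"
      by (rule finsum_ldistr) (use a b in auto)
    also have "\<dots> = (\<Oplus>k\<in>{..n}. [(n choose k)] \<cdot> (a [^] k \<otimes> b [^] (Suc n - k)))"
      by (rule finsum_cong') (use a b in \<open>auto simp: add_pow_ldistr add_pow_rdistr m_ac Suc_diff_le\<close>)
    also have "\<dots> = (\<Oplus>k\<in>{..Suc n}. [(n choose k)] \<cdot> (a [^] k \<otimes> b [^] (Suc n - k)))"
      by (subst finsum_Suc[OF closed]) (use a b closed in \<open>simp add: finsum_closed binomial_eq_0\<close>)
    also have "\<dots> = (\<Oplus>k\<in>{..n}. [(n choose Suc k)] \<cdot> (a [^] Suc k \<otimes> b [^] (n - k))) \<oplus> b [^] Suc n"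
      by (subst finsum_Suc2[OF closed]) (use a b in simp)
    finally show ?thesis using a b closed by (simp add: a_comm finsum_closed)
  qed
  have "(a \<oplus> b) [^] Suc n = ?S n \<otimes> a \<oplus> ?S n \<otimes> b"
    using a b S by (simp add: Suc.IH r_distr)
  also have "\<dots> = (\<Oplus>k\<in>{..n}. [(n choose k)] \<cdot> (a [^] Suc k \<otimes> b [^] (n - k)) \<oplus>
      [(n choose Suc k)] \<cdot> (a [^] Suc k \<otimes> b [^] (n - k))) \<oplus> b [^] Suc n"
    unfolding aS bS
    by (subst finsum_addf[OF closed closed])
      (use a b closed[of _ Suc "(-) n"] in \<open>simp add: a_ac finsum_closed del: nat_pow_Suc\<close>)
  also have "\<dots> = (\<Oplus>k\<in>{..n}. [(Suc n choose Suc k)] \<cdot> (a [^] Suc k \<otimes> b [^] (n - k))) \<oplus> b [^] Suc n"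
    by (rule arg_cong2[where f = "add R", OF finsum_cong' refl])
      (use a b in \<open>auto simp: add.nat_pow_mult simp del: nat_pow_Suc\<close>)
  also have "\<dots> = ?S (Suc n)"
    by (subst finsum_Suc2[OF closed]) (use a b in simp)
  finally show ?case .
qed

lemma add_pow_char_dvd:
  assumes "[p] \<cdot> \<one> = \<zero>" and "p dvd n" and "x \<in> carrier R"
  shows "[(n :: nat)] \<cdot> x = \<zero>"
proof -
  obtain m where n: "n = p * m" using assms by (auto elim: dvdE)
  have "[p] \<cdot> x = \<zero>"
    using add_pow_ldistr[of \<one> x p] assms by simp
  then show ?thesis
    using add.nat_pow_pow[OF assms(3), of m p] add.nat_pow_one by (simp add: n)
qed

lemma freshmans_dream:
  assumes p: "Factorial_Ring.prime (p::nat)" and char: "[p] \<cdot> \<one> = \<zero>"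
    and a: "a \<in> carrier R" and b: "b \<in> carrier R"
  shows "(a \<oplus> b) [^] p = a [^] p \<oplus> b [^] p"
proof -
  note closed = binomial_term_closed[OF a b]
  obtain m where m: "p = Suc (Suc m)"
    using prime_ge_2_nat[OF p] by (metis One_nat_def Suc_le_D Suc_1 Suc_le_mono)
  \<comment> \<open>The inner binomial coefficients, with index between 1 and p - 1, are divisible by p.\<close>
  have mid: "[(p choose Suc k)] \<cdot> (a [^] Suc k \<otimes> b [^] (p - Suc k)) = \<zero>" if "k \<le> m" for k
  proof (rule add_pow_char_dvd[OF char])
    show "p dvd (p choose Suc k)" using that m p by (intro dvd_choose_prime) auto
  qed (use a b in auto)
  have "(a \<oplus> b) [^] p = (\<Oplus>k\<in>{..Suc (Suc m)}. [(p choose k)] \<cdot> (a [^] k \<otimes> b [^] (p - k)))"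
    using binomial[OF a b, of p] unfolding m .
  also have "\<dots> = a [^] p \<oplus> ((\<Oplus>k\<in>{..m}. [(p choose Suc k)] \<cdot> (a [^] Suc k \<otimes> b [^] (p - Suc k))) \<oplus> b [^] p)"
    by (subst finsum_Suc[OF closed], subst finsum_Suc2[OF closed]) (use a b m in simp)
  also have "(\<Oplus>k\<in>{..m}. [(p choose Suc k)] \<cdot> (a [^] Suc k \<otimes> b [^] (p - Suc k))) = \<zero>"
    by (rule add.finprod_one_eqI) (use mid in auto)
  finally show ?thesis using a b by simp
qed

lemma freshmans_dream_iterated:
  assumes "Factorial_Ring.prime (p::nat)" and "[p] \<cdot> \<one> = \<zero>"
    and "a \<in> carrier R" and "b \<in> carrier R"
  shows "(a \<oplus> b) [^] (p ^ e) = a [^] (p ^ e) \<oplus> b [^] (p ^ e)"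
proof (induction e)
  case (Suc e)
  have "(a \<oplus> b) [^] (p ^ Suc e) = ((a \<oplus> b) [^] (p ^ e)) [^] p"
    using assms by (simp add: nat_pow_pow mult.commute)
  also have "\<dots> = (a [^] (p ^ e)) [^] p \<oplus> (b [^] (p ^ e)) [^] p"
    unfolding Suc using assms by (intro freshmans_dream) auto
  finally show ?case using assms by (simp add: nat_pow_pow mult.commute)
qed (use assms in simp)

lemma ring_char_eqI:
  assumes "Factorial_Ring.prime (p::nat)" "[p] \<cdot> \<one> = \<zero>" "\<one> \<noteq> \<zero>"
  shows "ring_char R = p"
proof -
  have dvd: "[n] \<cdot> \<one> = \<zero> \<longleftrightarrow> ring_char R dvd n" for n :: nat
    using add.pow_eq_id[of \<one> n] unfolding ring_char_def add_pow_def by simp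
  have "ring_char R dvd p" using dvd assms by simp
  moreover have "ring_char R \<noteq> 1" using dvd[of 1] assms by auto
  ultimately show ?thesis using assms(1) by (metis prime_nat_iff)
qed

lemma add_pow_ring_char: "[ring_char R] \<cdot> \<one> = \<zero>"
  using add.pow_eq_id[of \<one> "ring_char R"] unfolding ring_char_def add_pow_def by simp

section \<open>Integral elements\<close>

text \<open>In a trivial ring no polynomial has leading coefficient one, since leading coefficients are
  nonzero by convention; hence \<open>\<one> \<noteq> \<zero>\<close> is assumed.\<close>

lemma integral_over_root:
  assumes K: "subring K R" and b: "b \<in> carrier R" and q: "0 < (q::nat)" "b [^] q \<in> K"
    and nontriv: "\<one> \<noteq> \<zero>"
  shows "integral_over R K b"
proof -
  define f where "f = \<one> # (replicate (q - 1) \<zero> @ [\<ominus> (b [^] q)])"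
  have "set f \<subseteq> K" using subringE[OF K] q by (auto simp: f_def)
  then have "f \<in> carrier (K[X])"
    using nontriv by (simp add: univ_poly_carrier[symmetric] polynomial_def f_def)
  moreover have "eval (replicate (q - 1) \<zero> @ [\<ominus> (b [^] q)]) b = \<ominus> (b [^] q)"
    using b by (subst eval_replicate) auto
  then have "eval f b = \<zero>"
    using b q(1) unfolding f_def by (simp add: r_neg)
  ultimately show ?thesis
    unfolding integral_over_def by (intro bexI[of _ f]) (auto simp: f_def)
qed

text \<open>In an integral equation of degree \<open>n\<close>, the power \<open>b\<^sup>n\<close> is a polynomial expression in \<open>b\<close> of smaller
  degree; so this is the step by which a common denominator \<open>z\<close> of the lower powers of \<open>b\<close> becomes
  one of the next power.\<close>

lemma eval_smult_mem:
  assumes K: "subring K R" and b: "b \<in> carrier R" and z: "z \<in> carrier R"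
    and cs: "set cs \<subseteq> K" and pow: "\<And>i. i < j + length cs \<Longrightarrow> z \<otimes> b [^] (i::nat) \<in> K"
  shows "z \<otimes> b [^] j \<otimes> eval cs b \<in> K"
  using cs pow
proof (induction cs)
  case Nil
  then show ?case using b z subringE[OF K] by simp
next
  case (Cons c cs)
  have c: "c \<in> K" "c \<in> carrier R" "set cs \<subseteq> carrier R"
    using Cons.prems(1) subringE(1)[OF K] by auto
  have e: "eval cs b \<in> carrier R" by (rule eval_in_carrier) fact+
  have "z \<otimes> b [^] j \<otimes> eval (c # cs) b =
      c \<otimes> (z \<otimes> b [^] (j + length cs)) \<oplus> z \<otimes> b [^] j \<otimes> eval cs b"
    using b z c e by (simp add: r_distr m_ac nat_pow_mult[symmetric])
  also have "\<dots> \<in> K"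
    using Cons c subringE(6,7)[OF K] by simp
  finally show ?case .
qed

text \<open>A fraction \<open>b\<close> with denominator \<open>x\<close> that is integral has all its powers in a finitely generated
  module over \<open>K\<close>, spanned by the powers below the degree \<open>n\<close> of its equation. So \<open>x\<^sup>n\<close> is a
  denominator for every power of \<open>b\<close> at once.\<close>

lemma integral_common_denominator:
  assumes K: "subring K R" and b: "b \<in> carrier R" and int: "integral_over R K b"
    and x: "x \<in> K" and xb: "x \<otimes> b \<in> K"
  shows "\<exists>N::nat. \<forall>k::nat. x [^] N \<otimes> b [^] k \<in> K"
proof -
  obtain f where f: "f \<in> carrier (K[X])" "f \<noteq> []" "lead_coeff f = \<one>" "eval f b = \<zero>"
    using int by (auto simp: integral_over_def)
  then obtain cs where cs: "f = \<one> # cs" by (cases f) auto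
  have csK: "set cs \<subseteq> K"
    using f(1) by (auto simp: univ_poly_carrier[symmetric] polynomial_def cs)
  have xc: "x \<in> carrier R" and csR: "set cs \<subseteq> carrier R"
    using x csK subringE(1)[OF K] by auto
  have e: "eval cs b \<in> carrier R" by (rule eval_in_carrier) fact+
  define n where "n = length cs"
  have "b [^] n \<oplus> eval cs b = \<zero>" using f(4) b e by (simp add: cs n_def)
  then have bn: "b [^] n = \<ominus> eval cs b" using b e by (simp add: minus_equality)
  have powK: "y [^] (m::nat) \<in> K" if "y \<in> K" for y m
    using that by (induction m) (auto intro: subringE[OF K])
  have "x [^] n \<otimes> b [^] k \<in> K" for k :: nat
  proof (induction k rule: less_induct)
    case (less k)
    show ?case
    proof (cases "k \<le> n")
      case True
      then have "x [^] n \<otimes> b [^] k = x [^] (n - k) \<otimes> (x \<otimes> b) [^] k"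
        using b xc by (simp add: nat_pow_distrib m_assoc[symmetric] nat_pow_mult)
      then show ?thesis using x xb powK subringE(6)[OF K] by simp
    next
      case False
      then have "x [^] n \<otimes> b [^] k = x [^] n \<otimes> b [^] (k - n) \<otimes> b [^] n"
        using b xc by (simp add: m_assoc nat_pow_mult)
      also have "\<dots> = \<ominus> (x [^] n \<otimes> b [^] (k - n) \<otimes> eval cs b)"
        unfolding bn using b xc e by (simp add: r_minus)
      also have "\<dots> \<in> K"
        using less False by (intro subringE(5)[OF K] eval_smult_mem[OF K b _ csK])
          (use xc in \<open>auto simp: n_def[symmetric]\<close>)
      finally show ?thesis .
    qed
  qed
  then show ?thesis by (intro exI[of _ n] allI)
qed

end


section \<open>Residue fields\<close>

lemma add_pow_one_hom:
  assumes "ring A" "ring B" "h \<in> ring_hom A B"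
  shows "h ([(n::nat)] \<cdot>\<^bsub>A\<^esub> \<one>\<^bsub>A\<^esub>) = [n] \<cdot>\<^bsub>B\<^esub> \<one>\<^bsub>B\<^esub>"
proof -
  interpret A: ring A by fact
  interpret B: ring B by fact
  show ?thesis
    using ring_hom_zero[OF assms(3,1,2)]
    by (induction n) (simp_all add: ring_hom_add[OF assms(3)] ring_hom_one[OF assms(3)])
qed

lemma ring_hom_pow:
  assumes "ring A" "h \<in> ring_hom A B" "a \<in> carrier A"
  shows "h (a [^]\<^bsub>A\<^esub> (n::nat)) = h a [^]\<^bsub>B\<^esub> n"
proof -
  interpret A: ring A by fact
  show ?thesis
    using assms(3)
    by (induction n) (simp_all add: ring_hom_mult[OF assms(2)] ring_hom_one[OF assms(2)])
qed

text \<open>The map is a union over representatives, which all have the same image.\<close>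

lemma localization_map_mk_frac:
  assumes A: "fractions A S" and B: "fractions B T"
    and f: "f \<in> ring_hom A B" "f ` S \<subseteq> T"
    and a: "a \<in> carrier A" and s: "s \<in> S"
  shows "localization_map B T f (mk_frac A S a s) = mk_frac B T (f a) (f s)"
proof -
  interpret A: fractions A S by fact
  interpret B: fractions B T by fact
  have *: "mk_frac B T (f a') (f s') = mk_frac B T (f a) (f s)"
    if mem: "(a', s') \<in> mk_frac A S a s" for a' s'
  proof -
    obtain u where c: "a' \<in> carrier A" "s' \<in> S" "u \<in> S"
      and u: "u \<otimes>\<^bsub>A\<^esub> (s' \<otimes>\<^bsub>A\<^esub> a) = u \<otimes>\<^bsub>A\<^esub> (s \<otimes>\<^bsub>A\<^esub> a')"
      using mem unfolding mk_frac_def by (auto simp: A.frac_rel_iff)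
    have "f u \<otimes>\<^bsub>B\<^esub> (f s' \<otimes>\<^bsub>B\<^esub> f a) = f u \<otimes>\<^bsub>B\<^esub> (f s \<otimes>\<^bsub>B\<^esub> f a')"
      using arg_cong[OF u, of f] c a s
      by (simp add: ring_hom_mult[OF f(1)] A.m_closed)
    then show ?thesis
      using c a s f by (subst B.mk_frac_eq_iff) (auto simp: ring_hom_closed[OF f(1)] intro!: bexI[of _ "f u"])
  qed
  have self: "(a, s) \<in> mk_frac A S a s"
    using a s A.one_denom by (auto simp: mk_frac_def A.frac_rel_iff)
  show ?thesis
    unfolding localization_map_def
  proof (rule SUP_eq_const)
    show "mk_frac A S a s \<noteq> {}" using self by blast
    show "(case z of (a', s') \<Rightarrow> mk_frac B T (f a') (f s')) = mk_frac B T (f a) (f s)"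
      if "z \<in> mk_frac A S a s" for z
      using that * by (cases z) simp
  qed
qed

lemma (in primeideal) rcos_eq_zero_iff:
  "a \<in> carrier R \<Longrightarrow> I +> a = \<zero>\<^bsub>R Quot I\<^esub> \<longleftrightarrow> a \<in> I"
  by (metis FactRing_def a_rcos_const a_rcos_self ring.simps(1))

lemma domain_fractions:
  assumes "domain D"
  shows "fractions D (carrier D - {\<zero>\<^bsub>D\<^esub>})"
proof -
  interpret domain D by fact
  show ?thesis
    by unfold_locales (auto simp: integral_iff)
qed

lemma nonzerodivisors_fractions:
  fixes R (structure)
  assumes "cring R"
  shows "fractions R (nonzerodivisors R)"
proof -
  interpret cring R by fact
  show ?thesis
  proof unfold_locales
    show "nonzerodivisors R \<subseteq> carrier R" "\<one> \<in> nonzerodivisors R"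
      by (auto simp: nonzerodivisors_def)
    fix s t assume "s \<in> nonzerodivisors R" "t \<in> nonzerodivisors R"
    then have s: "s \<in> carrier R" "\<And>a. a \<in> carrier R \<Longrightarrow> s \<otimes> a = \<zero> \<Longrightarrow> a = \<zero>"
      and t: "t \<in> carrier R" "\<And>a. a \<in> carrier R \<Longrightarrow> t \<otimes> a = \<zero> \<Longrightarrow> a = \<zero>"
      unfolding nonzerodivisors_def by blast+
    have "a = \<zero>" if "a \<in> carrier R" "s \<otimes> t \<otimes> a = \<zero>" for a
    proof -
      have "t \<otimes> a = \<zero>"
        by (rule s(2)) (use that(2) in \<open>simp_all add: m_assoc s(1) t(1) that(1)\<close>)
      then show ?thesis by (rule t(2)[OF that(1)])
    qed
    then show "s \<otimes> t \<in> nonzerodivisors R"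
      unfolding nonzerodivisors_def using m_closed[OF s(1) t(1)] by blast
  qed
qed

lemma exponential_char_residue_field:
  assumes "cring A" and P: "primeideal P A"
    and p: "Factorial_Ring.prime (p::nat)" "[p] \<cdot>\<^bsub>A\<^esub> \<one>\<^bsub>A\<^esub> = \<zero>\<^bsub>A\<^esub>"
  shows "exponential_char (residue_field A P) = p"
proof -
  interpret A: cring A by fact
  interpret P: primeideal P A by fact
  interpret D: domain "A Quot P" by (rule P.quotient_is_domain)
  interpret F: fractions "A Quot P" "carrier (A Quot P) - {\<zero>\<^bsub>A Quot P\<^esub>}"
    by (rule domain_fractions) (rule D.domain_axioms)
  let ?K = "residue_field A P"
  have K: "?K = localization (A Quot P) (carrier (A Quot P) - {\<zero>\<^bsub>A Quot P\<^esub>})"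
    by (simp add: residue_field_def fraction_field_def)
  interpret K: cring ?K unfolding K by (rule F.localization_cring)
  have "[p] \<cdot>\<^bsub>A Quot P\<^esub> \<one>\<^bsub>A Quot P\<^esub> = \<zero>\<^bsub>A Quot P\<^esub>"
    using add_pow_one_hom[OF A.ring_axioms D.ring_axioms P.rcos_ring_hom, of p] p(2)
      P.rcos_eq_zero_iff[of "\<zero>\<^bsub>A\<^esub>"] P.zero_closed by simp
  then have "[p] \<cdot>\<^bsub>?K\<^esub> \<one>\<^bsub>?K\<^esub> = \<zero>\<^bsub>?K\<^esub>"
    using add_pow_one_hom[OF D.ring_axioms K.ring_axioms F.frac_hom[folded K], of p]
    by (simp add: F.zero_localization[folded K])
  moreover have "\<one>\<^bsub>?K\<^esub> \<noteq> \<zero>\<^bsub>?K\<^esub>"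
    unfolding K F.one_localization F.zero_localization
    by (subst F.mk_frac_eq_iff) (auto simp: F.one_denom)
  ultimately have "ring_char ?K = p" by (intro K.ring_char_eqI p(1))
  then show ?thesis using p(1) by (simp add: exponential_char_def)
qed

section \<open>Radicial extensions are weakly subintegral\<close>

text \<open>Some \<open>p\<close>-power of each element of \<open>B\<close> lies in \<open>A\<close>. Thus \<open>B\<close> differs from \<open>A\<close> only by \<open>p\<close>-power
  roots, which neither separate primes nor extend residue fields separably.\<close>

locale p_radical_extension = ring_hom_cring A B i for A (structure) and B (structure) and i +
  fixes p :: nat
  assumes prime: "Factorial_Ring.prime p"
    and char: "[p] \<cdot>\<^bsub>A\<^esub> \<one>\<^bsub>A\<^esub> = \<zero>\<^bsub>A\<^esub>"
    and nontriv: "\<one>\<^bsub>B\<^esub> \<noteq> \<zero>\<^bsub>B\<^esub>"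
    and inj: "inj_on i (carrier A)"
    and radical: "b \<in> carrier B \<Longrightarrow> \<exists>e. b [^]\<^bsub>B\<^esub> (p ^ e) \<in> i ` carrier A"
begin

lemma char_B: "[p] \<cdot>\<^bsub>B\<^esub> \<one>\<^bsub>B\<^esub> = \<zero>\<^bsub>B\<^esub>"
  using add_pow_one_hom[OF R.ring_axioms S.ring_axioms homh, of p] by (simp add: char)

lemma i_pow: "a \<in> carrier A \<Longrightarrow> i (a [^]\<^bsub>A\<^esub> (n::nat)) = i a [^]\<^bsub>B\<^esub> n"
  by (rule ring_hom_pow[OF R.ring_axioms homh])

lemma inj_eq: "a \<in> carrier A \<Longrightarrow> a' \<in> carrier A \<Longrightarrow> i a = i a' \<longleftrightarrow> a = a'"
  using inj by (auto dest: inj_onD)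

lemma image_subring: "subring (i ` carrier A) B"
  using ring_hom_ring.img_is_subring[OF _ R.carrier_is_subring, of B i]
    ring_hom_ringI2[OF R.ring_axioms S.ring_axioms homh] by simp

lemma root_exponent_mono:
  assumes "b \<in> carrier B" "a \<in> carrier A" "b [^]\<^bsub>B\<^esub> (p ^ e) = i a" "e \<le> e'"
  shows "b [^]\<^bsub>B\<^esub> (p ^ e') = i (a [^]\<^bsub>A\<^esub> (p ^ (e' - e)))"
proof -
  have "p ^ e' = p ^ e * p ^ (e' - e)" using assms(4) by (simp flip: power_add)
  then show ?thesis
    using assms by (simp add: i_pow S.nat_pow_pow[symmetric])
qed

lemma common_root_exponent:
  assumes "b \<in> carrier B" "c \<in> carrier B"
  obtains e a a' where "a \<in> carrier A" "a' \<in> carrier A"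
    "b [^]\<^bsub>B\<^esub> (p ^ e) = i a" "c [^]\<^bsub>B\<^esub> (p ^ e) = i a'"
proof -
  obtain e1 a1 e2 a2 where "a1 \<in> carrier A" "b [^]\<^bsub>B\<^esub> (p ^ e1) = i a1"
      "a2 \<in> carrier A" "c [^]\<^bsub>B\<^esub> (p ^ e2) = i a2"
    using radical[OF assms(1)] radical[OF assms(2)] by auto
  then show thesis
    using root_exponent_mono[of b a1 e1 "max e1 e2"] root_exponent_mono[of c a2 e2 "max e1 e2"] assms
    by (intro that[of "a1 [^]\<^bsub>A\<^esub> (p ^ (max e1 e2 - e1))" "a2 [^]\<^bsub>A\<^esub> (p ^ (max e1 e2 - e2))" "max e1 e2"])
      auto
qed

lemma prime_pow_mem:
  assumes "primeideal P B" "b \<in> carrier B" "b [^]\<^bsub>B\<^esub> (n::nat) \<in> P"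
  shows "b \<in> P"
proof -
  interpret P: primeideal P B by fact
  show ?thesis using assms(3)
  proof (induction n)
    case 0
    then show ?case using P.one_imp_carrier assms(2) by simp
  next
    case (Suc n)
    then show ?case using P.I_prime[of "b [^]\<^bsub>B\<^esub> n" b] assms(2) by auto
  qed
qed

lemma prime_mem_iff:
  assumes P: "primeideal P B" and b: "b \<in> carrier B"
    and a: "a \<in> carrier A" "b [^]\<^bsub>B\<^esub> (p ^ e) = i a"
  shows "b \<in> P \<longleftrightarrow> a \<in> contraction A i P"
proof -
  interpret P: primeideal P B by fact
  have "b [^]\<^bsub>B\<^esub> (Suc n) \<in> P" if "b \<in> P" for n :: nat
    using that b P.I_l_closed by simp
  moreover have "p ^ e = Suc (p ^ e - 1)" using prime_gt_0_nat[OF prime] by simp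
  ultimately have "b [^]\<^bsub>B\<^esub> (p ^ e) \<in> P" if "b \<in> P" using that by metis
  then show ?thesis
    using a prime_pow_mem[OF P b, of "p ^ e"] by (auto simp: contraction_def)
qed

lemma contraction_prime:
  assumes "primeideal P B" shows "primeideal (contraction A i P) A"
  using ring_hom_ring.primeideal_vimage[OF _ R.is_cring assms, of i]
    ring_hom_ringI2[OF R.ring_axioms S.ring_axioms homh] by (simp add: contraction_def)

text \<open>The radical of the extension of \<open>P\<close> to \<open>B\<close>, which is the only prime of \<open>B\<close> above \<open>P\<close>.\<close>

definition prime_over :: "'a set \<Rightarrow> 'c set" where
  "prime_over P = {b \<in> carrier B. \<exists>e. b [^]\<^bsub>B\<^esub> (p ^ e) \<in> i ` P}"

text \<open>Membership may be tested on any \<open>p\<close>-power that lies in \<open>A\<close>: two such powers have a common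
  power, and \<open>P\<close> is prime.\<close>

lemma prime_over_mem_iff:
  assumes P: "primeideal P A" and b: "b \<in> carrier B"
    and a: "a \<in> carrier A" "b [^]\<^bsub>B\<^esub> (p ^ e) = i a"
  shows "b \<in> prime_over P \<longleftrightarrow> a \<in> P"
proof
  interpret P: primeideal P A by fact
  assume "b \<in> prime_over P"
  then obtain e' a' where a': "a' \<in> P" "b [^]\<^bsub>B\<^esub> (p ^ e') = i a'"
    by (auto simp: prime_over_def)
  have "i (a [^]\<^bsub>A\<^esub> (p ^ e')) = i (a' [^]\<^bsub>A\<^esub> (p ^ e))"
    using a a' b P.Icarr by (simp add: i_pow S.nat_pow_pow mult.commute flip: a(2) a'(2))
  then have eq: "a [^]\<^bsub>A\<^esub> (p ^ e') = a' [^]\<^bsub>A\<^esub> (p ^ e)"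
    by (rule inj_eq[THEN iffD1, rotated 2]) (use a a' P.Icarr in auto)
  have "a' [^]\<^bsub>A\<^esub> Suc n \<in> P" for n :: nat
    using a'(1) P.Icarr P.I_l_closed by simp
  moreover have "p ^ e = Suc (p ^ e - 1)" using prime_gt_0_nat[OF prime] by simp
  ultimately have mem: "a [^]\<^bsub>A\<^esub> (p ^ e') \<in> P" unfolding eq by metis
  have "a \<in> P" if "a [^]\<^bsub>A\<^esub> n \<in> P" for n :: nat
    using that
  proof (induction n)
    case 0
    then show ?case using P.one_imp_carrier a(1) by simp
  next
    case (Suc n)
    then show ?case using P.I_prime[of "a [^]\<^bsub>A\<^esub> n" a] a(1) by auto
  qed
  from this[OF mem] show "a \<in> P" .
next
  assume "a \<in> P"
  then show "b \<in> prime_over P" using a b by (auto simp: prime_over_def intro!: exI[of _ e])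
qed

text \<open>Two elements of \<open>B\<close> have a common exponent \<open>p\<^sup>e\<close> that moves both into \<open>A\<close>. Taking the power with
  that exponent commutes with products and, in characteristic \<open>p\<close>, with sums, so the prime ideal
  conditions for \<open>P\<close> pull back.\<close>

lemma prime_over_prime:
  assumes P: "primeideal P A" shows "primeideal (prime_over P) B"
proof (rule primeidealI)
  interpret P: primeideal P A by fact
  note mem = prime_over_mem_iff[OF P]
  have sum: "b \<oplus>\<^bsub>B\<^esub> c \<in> prime_over P" if "b \<in> prime_over P" "c \<in> prime_over P" for b c
  proof -
    have bc: "b \<in> carrier B" "c \<in> carrier B" using that by (auto simp: prime_over_def)
    obtain e a a' where a: "a \<in> carrier A" "a' \<in> carrier A"
        "b [^]\<^bsub>B\<^esub> (p ^ e) = i a" "c [^]\<^bsub>B\<^esub> (p ^ e) = i a'"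
      using bc by (rule common_root_exponent)
    have "(b \<oplus>\<^bsub>B\<^esub> c) [^]\<^bsub>B\<^esub> (p ^ e) = i (a \<oplus>\<^bsub>A\<^esub> a')"
      using bc a S.freshmans_dream_iterated[OF prime char_B] by simp
    moreover have "a \<in> P" "a' \<in> P" using that bc a mem by blast+
    ultimately show ?thesis using bc a by (subst mem[of _ "a \<oplus>\<^bsub>A\<^esub> a'" e]) auto
  qed
  have mult: "c \<otimes>\<^bsub>B\<^esub> b \<in> prime_over P \<longleftrightarrow> c \<in> prime_over P \<or> b \<in> prime_over P"
    if bc: "b \<in> carrier B" "c \<in> carrier B" for b c
  proof -
    obtain e a a' where a: "a \<in> carrier A" "a' \<in> carrier A"
        "b [^]\<^bsub>B\<^esub> (p ^ e) = i a" "c [^]\<^bsub>B\<^esub> (p ^ e) = i a'"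
      using bc by (rule common_root_exponent)
    have "(c \<otimes>\<^bsub>B\<^esub> b) [^]\<^bsub>B\<^esub> (p ^ e) = i (a' \<otimes>\<^bsub>A\<^esub> a)"
      using bc a by (simp add: S.nat_pow_distrib)
    then have "c \<otimes>\<^bsub>B\<^esub> b \<in> prime_over P \<longleftrightarrow> a' \<otimes>\<^bsub>A\<^esub> a \<in> P"
      using bc a by (intro mem) auto
    also have "\<dots> \<longleftrightarrow> a' \<in> P \<or> a \<in> P"
      using a P.I_prime P.I_l_closed P.I_r_closed by blast
    finally show ?thesis using mem[OF bc(1) a(1,3)] mem[OF bc(2) a(2,4)] by simp
  qed
  have zero: "\<zero>\<^bsub>B\<^esub> \<in> prime_over P"
    by (subst mem[of _ "\<zero>\<^bsub>A\<^esub>" 0]) auto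
  have one: "\<one>\<^bsub>B\<^esub> \<notin> prime_over P"
    using P.I_notcarr P.one_imp_carrier by (subst mem[of _ "\<one>\<^bsub>A\<^esub>" 0]) auto
  have sub: "prime_over P \<subseteq> carrier B" by (auto simp: prime_over_def)
  show "cring B" by (rule S.is_cring)
  show "ideal (prime_over P) B"
  proof (rule idealI)
    show "ring B" by (rule S.ring_axioms)
    show "subgroup (prime_over P) (add_monoid B)"
    proof (rule S.add.subgroupI)
      show "\<ominus>\<^bsub>B\<^esub> b \<in> prime_over P" if "b \<in> prime_over P" for b
      proof -
        have "\<ominus>\<^bsub>B\<^esub> b = (\<ominus>\<^bsub>B\<^esub> \<one>\<^bsub>B\<^esub>) \<otimes>\<^bsub>B\<^esub> b" using that sub by (simp add: S.l_minus subsetD)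
        then show ?thesis using mult[of b "\<ominus>\<^bsub>B\<^esub> \<one>\<^bsub>B\<^esub>"] that sub by auto
      qed
    qed (use sub zero sum in auto)
    show "x \<otimes>\<^bsub>B\<^esub> b \<in> prime_over P" if "b \<in> prime_over P" "x \<in> carrier B" for b x
      using mult[of b x] that sub by auto
    show "b \<otimes>\<^bsub>B\<^esub> x \<in> prime_over P" if "b \<in> prime_over P" "x \<in> carrier B" for b x
      using mult[of x b] that sub by auto
  qed
  show "carrier B \<noteq> prime_over P" using one by auto
  show "a \<in> prime_over P \<or> b \<in> prime_over P"
    if "a \<in> carrier B" "b \<in> carrier B" "a \<otimes>\<^bsub>B\<^esub> b \<in> prime_over P" for a b
    using mult[of b a] that by auto
qed

lemma Spec_bij: "bij_betw (contraction A i) (Spec B) (Spec A)"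
proof (rule bij_betw_byWitness[where f' = prime_over])
  show "\<forall>P \<in> Spec B. prime_over (contraction A i P) = P"
  proof
    fix P assume "P \<in> Spec B"
    then have P: "primeideal P B" by (simp add: Spec_def)
    have sub: "P \<subseteq> carrier B" using ideal.Icarr[OF primeideal.axioms(1)[OF P]] by (rule subsetI)
    have "b \<in> prime_over (contraction A i P) \<longleftrightarrow> b \<in> P" if b: "b \<in> carrier B" for b
    proof -
      obtain e a where a: "a \<in> carrier A" "b [^]\<^bsub>B\<^esub> (p ^ e) = i a" using radical[OF b] by auto
      show ?thesis
        using prime_over_mem_iff[OF contraction_prime[OF P] b a] prime_mem_iff[OF P b a] by simp
    qed
    then show "prime_over (contraction A i P) = P"
      using sub by (auto simp: prime_over_def)
  qed
  show "\<forall>P \<in> Spec A. contraction A i (prime_over P) = P"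
  proof
    fix P assume "P \<in> Spec A"
    then have P: "primeideal P A" by (simp add: Spec_def)
    have sub: "P \<subseteq> carrier A" using ideal.Icarr[OF primeideal.axioms(1)[OF P]] by (rule subsetI)
    have "i a \<in> prime_over P \<longleftrightarrow> a \<in> P" if "a \<in> carrier A" for a
      using that by (intro prime_over_mem_iff[OF P, of _ _ 0]) auto
    then show "contraction A i (prime_over P) = P"
      using sub by (auto simp: contraction_def)
  qed
  show "contraction A i ` Spec B \<subseteq> Spec A"
    using contraction_prime by (auto simp: Spec_def)
  show "prime_over ` Spec A \<subseteq> Spec B"
    using prime_over_prime by (auto simp: Spec_def)
qed

text \<open>Clear the roots from the numerator and the denominator of a fraction in the residue field at
  \<open>P\<close> with one exponent; the resulting fraction comes from \<open>A\<close>.\<close>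

lemma residue_field_purely_inseparable:
  assumes P: "primeideal P B"
  shows "purely_inseparable (residue_field A (contraction A i P)) (residue_field B P)
    (residue_map B i P)"
proof -
  define P' where "P' = contraction A i P"
  have P'prime: "primeideal P' A" unfolding P'_def by (rule contraction_prime[OF P])
  interpret P: primeideal P B by fact
  interpret P': primeideal P' A by fact
  interpret DA: domain "A Quot P'" by (rule P'.quotient_is_domain)
  interpret DB: domain "B Quot P" by (rule P.quotient_is_domain)
  define SA where "SA = carrier (A Quot P') - {\<zero>\<^bsub>A Quot P'\<^esub>}"
  define SB where "SB = carrier (B Quot P) - {\<zero>\<^bsub>B Quot P\<^esub>}"
  interpret FA: fractions "A Quot P'" SA
    unfolding SA_def by (rule domain_fractions) (rule DA.domain_axioms)
  interpret FB: fractions "B Quot P" SB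
    unfolding SB_def by (rule domain_fractions) (rule DB.domain_axioms)
  have KA: "residue_field A P' = localization (A Quot P') SA"
    and KB: "residue_field B P = localization (B Quot P) SB"
    by (simp_all add: residue_field_def fraction_field_def SA_def SB_def)
  have carA: "carrier (A Quot P') = (\<lambda>a. P' +>\<^bsub>A\<^esub> a) ` carrier A"
    and carB: "carrier (B Quot P) = (\<lambda>b. P +>\<^bsub>B\<^esub> b) ` carrier B"
    by (auto simp: FactRing_def A_RCOSETS_def')
  \<comment> \<open>The map of domains A / P' \<rightarrow> B / P underlying the map of residue fields.\<close>
  define f where "f = (\<lambda>U. \<Union>a\<in>U. P +>\<^bsub>B\<^esub> i a)"
  have f: "f (P' +>\<^bsub>A\<^esub> a) = P +>\<^bsub>B\<^esub> i a" if a: "a \<in> carrier A" for a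
  proof -
    have "P +>\<^bsub>B\<^esub> i a' = P +>\<^bsub>B\<^esub> i a" if a': "a' \<in> P' +>\<^bsub>A\<^esub> a" for a'
    proof -
      obtain h where h: "h \<in> P'" "a' = h \<oplus>\<^bsub>A\<^esub> a" using a' by (auto simp: a_r_coset_def')
      from h(1) have ih: "i h \<in> P" "h \<in> carrier A"
        unfolding P'_def contraction_def by simp_all
      then have "i a' = i h \<oplus>\<^bsub>B\<^esub> i a" using h(2) a by simp
      then have "i a' \<in> P +>\<^bsub>B\<^esub> i a" using ih(1) unfolding a_r_coset_def' by blast
      then show ?thesis
        using P.a_repr_independence'[of "i a'" "i a"] a by simp
    qed
    moreover have "a \<in> P' +>\<^bsub>A\<^esub> a" using a by (rule P'.a_rcos_self)
    ultimately show ?thesis unfolding f_def by blast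
  qed
  have f_hom: "f \<in> ring_hom (A Quot P') (B Quot P)"
  proof (rule ring_hom_memI)
    fix U assume "U \<in> carrier (A Quot P')"
    then show "f U \<in> carrier (B Quot P)" by (auto simp: carA carB f)
  next
    fix U V assume "U \<in> carrier (A Quot P')" "V \<in> carrier (A Quot P')"
    then obtain u v where uv: "u \<in> carrier A" "v \<in> carrier A" "U = P' +>\<^bsub>A\<^esub> u" "V = P' +>\<^bsub>A\<^esub> v"
      by (auto simp: carA)
    then show "f (U \<otimes>\<^bsub>A Quot P'\<^esub> V) = f U \<otimes>\<^bsub>B Quot P\<^esub> f V"
      by (simp add: f ring_hom_mult[OF P'.rcos_ring_hom, symmetric]
          ring_hom_mult[OF P.rcos_ring_hom, symmetric])
    from uv show "f (U \<oplus>\<^bsub>A Quot P'\<^esub> V) = f U \<oplus>\<^bsub>B Quot P\<^esub> f V"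
      by (simp add: f ring_hom_add[OF P'.rcos_ring_hom, symmetric]
          ring_hom_add[OF P.rcos_ring_hom, symmetric])
  next
    show "f \<one>\<^bsub>A Quot P'\<^esub> = \<one>\<^bsub>B Quot P\<^esub>"
      by (simp add: f ring_hom_one[OF P'.rcos_ring_hom, symmetric]
          ring_hom_one[OF P.rcos_ring_hom, symmetric])
  qed
  have SA_iff: "P' +>\<^bsub>A\<^esub> t \<in> SA \<longleftrightarrow> P +>\<^bsub>B\<^esub> i t \<in> SB" if "t \<in> carrier A" for t
  proof -
    have "P' +>\<^bsub>A\<^esub> t \<in> SA \<longleftrightarrow> t \<notin> P'"
      by (simp only: SA_def Diff_iff singleton_iff P'.rcos_eq_zero_iff[OF that]
          ring_hom_closed[OF P'.rcos_ring_hom that] simp_thms)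
    also have "\<dots> \<longleftrightarrow> i t \<notin> P"
      by (simp only: P'_def contraction_def mem_Collect_eq that simp_thms)
    also have "\<dots> \<longleftrightarrow> P +>\<^bsub>B\<^esub> i t \<in> SB"
      by (simp only: SB_def Diff_iff singleton_iff P.rcos_eq_zero_iff[OF hom_closed[OF that]]
          ring_hom_closed[OF P.rcos_ring_hom hom_closed[OF that]] simp_thms)
    finally show ?thesis .
  qed
  have f_denom: "f ` SA \<subseteq> SB"
  proof
    fix V assume "V \<in> f ` SA"
    then obtain t where "t \<in> carrier A" "P' +>\<^bsub>A\<^esub> t \<in> SA" "V = f (P' +>\<^bsub>A\<^esub> t)"
      unfolding SA_def carA by blast
    then show "V \<in> SB" using SA_iff f by simp
  qed
  have map: "residue_map B i P (mk_frac (A Quot P') SA (P' +>\<^bsub>A\<^esub> a) (P' +>\<^bsub>A\<^esub> t)) =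
      mk_frac (B Quot P) SB (P +>\<^bsub>B\<^esub> i a) (P +>\<^bsub>B\<^esub> i t)"
    if "a \<in> carrier A" "t \<in> carrier A" "P' +>\<^bsub>A\<^esub> t \<in> SA" for a t
    using localization_map_mk_frac[OF FA.fractions_axioms FB.fractions_axioms f_hom f_denom,
        of "P' +>\<^bsub>A\<^esub> a" "P' +>\<^bsub>A\<^esub> t"] that
    by (simp add: residue_map_def f_def[symmetric] SB_def[symmetric] f carA)
  have "\<exists>n::nat. x [^]\<^bsub>residue_field B P\<^esub> (p ^ n) \<in> residue_map B i P ` carrier (residue_field A P')"
    if x: "x \<in> carrier (residue_field B P)" for x
  proof -
    obtain b s where bs: "b \<in> carrier B" "s \<in> carrier B" "P +>\<^bsub>B\<^esub> s \<in> SB"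
      and x_eq: "x = mk_frac (B Quot P) SB (P +>\<^bsub>B\<^esub> b) (P +>\<^bsub>B\<^esub> s)"
      using x unfolding KB by (elim FB.localization_cases) (auto simp: carB SB_def)
    obtain e a t where at: "a \<in> carrier A" "t \<in> carrier A"
        "b [^]\<^bsub>B\<^esub> (p ^ e) = i a" "s [^]\<^bsub>B\<^esub> (p ^ e) = i t"
      using bs(1,2) by (rule common_root_exponent)
    note pow = ring_hom_pow[OF S.ring_axioms P.rcos_ring_hom]
    have car: "P +>\<^bsub>B\<^esub> b \<in> carrier (B Quot P)" using bs by (simp add: carB)
    have "x [^]\<^bsub>residue_field B P\<^esub> (p ^ e) = mk_frac (B Quot P) SB (P +>\<^bsub>B\<^esub> i a) (P +>\<^bsub>B\<^esub> i t)"
      unfolding KB x_eq FB.mk_frac_pow(2)[OF car bs(3)]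
      using bs at by (simp flip: pow)
    moreover have "P' +>\<^bsub>A\<^esub> t \<in> SA"
      using FB.mk_frac_pow(1)[OF car bs(3), of "p ^ e"] bs at by (simp add: SA_iff flip: pow)
    ultimately show ?thesis
      using map[OF at(1,2)] FA.mk_frac_closed[of "P' +>\<^bsub>A\<^esub> a" "P' +>\<^bsub>A\<^esub> t"] imageI[OF at(1)]
      unfolding KA carA by (metis imageI)
  qed
  then show ?thesis
    unfolding purely_inseparable_def P'_def[symmetric]
      exponential_char_residue_field[OF R.is_cring P'prime prime char] by blast
qed

theorem p_radical_imp_weakly_subintegral: "weakly_subintegral A B i"
  unfolding weakly_subintegral_def
proof (intro conjI ballI)
  show "integral_over B (i ` carrier A) b" if b: "b \<in> carrier B" for b
  proof -
    obtain e where "b [^]\<^bsub>B\<^esub> (p ^ e) \<in> i ` carrier A" using radical[OF b] ..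
    then show ?thesis
      using prime_gt_0_nat[OF prime]
      by (intro S.integral_over_root[OF image_subring b _ _ nontriv]) auto
  qed
  show "purely_inseparable (residue_field A (contraction A i P)) (residue_field B P)
    (residue_map B i P)" if "P \<in> Spec B" for P
    using that by (intro residue_field_purely_inseparable) (simp add: Spec_def)
qed (use inj Spec_bij in auto)

end


section \<open>From a power to the element\<close>

locale total_quotient = fractions R "nonzerodivisors R" for R (structure)
begin

abbreviation Q where "Q \<equiv> total_quotient_ring R"
abbreviation \<iota> where "\<iota> \<equiv> quot_embed R"

sublocale Q: cring Q
  unfolding total_quotient_ring_def by (rule localization_cring)

lemma quot_embed_hom: "\<iota> \<in> ring_hom R Q"
  using frac_hom unfolding total_quotient_ring_def quot_embed_def[abs_def] quot_elem_def .

lemma nonzerodivisor_cancel: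
  assumes "x \<in> nonzerodivisors R" "a \<in> carrier R" "b \<in> carrier R" "x \<otimes> a = x \<otimes> b"
  shows "a = b"
proof -
  have x: "x \<in> carrier R" "\<And>c. c \<in> carrier R \<Longrightarrow> x \<otimes> c = \<zero> \<Longrightarrow> c = \<zero>"
    using assms(1) unfolding nonzerodivisors_def by blast+
  have "x \<otimes> (a \<ominus> b) = x \<otimes> a \<ominus> x \<otimes> b"
    using x(1) assms(2,3) by (simp add: minus_eq r_distr r_minus)
  also have "\<dots> = \<zero>" unfolding assms(4) using x(1) assms(3) by (simp add: minus_eq r_neg)
  finally have "a \<ominus> b = \<zero>" by (rule x(2)[rotated]) (simp add: assms(2,3))
  then show ?thesis using assms(2,3) by simp
qed

lemma quot_embed_eq_iff:
  assumes "a \<in> carrier R" "s \<in> nonzerodivisors R" "b \<in> carrier R"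
  shows "quot_elem R a s = \<iota> b \<longleftrightarrow> a = s \<otimes> b"
  unfolding quot_embed_def quot_elem_def using assms
  by (subst mk_frac_eq_iff)
    (auto simp: one_denom intro: nonzerodivisor_cancel[of _ a "s \<otimes> b"])

lemma quot_embed_inj: "inj_on \<iota> (carrier R)"
proof (rule inj_onI)
  fix a b assume "a \<in> carrier R" "b \<in> carrier R" "\<iota> a = \<iota> b"
  then show "a = b"
    using quot_embed_eq_iff[of a \<one> b] by (simp add: one_denom quot_embed_def)
qed

lemma quot_embed_subring: "subring (\<iota> ` carrier R) Q"
  using ring_hom_ring.img_is_subring[OF _ carrier_is_subring, of Q \<iota>]
    ring_hom_ringI2[OF ring_axioms Q.ring_axioms quot_embed_hom] by simp

lemma one_not_zero_Q:
  assumes "\<one> \<noteq> \<zero>" shows "\<one>\<^bsub>Q\<^esub> \<noteq> \<zero>\<^bsub>Q\<^esub>"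
  using inj_onD[OF quot_embed_inj, of \<one> \<zero>] assms ring_hom_one[OF quot_embed_hom]
    ring_hom_zero[OF quot_embed_hom ring_axioms Q.ring_axioms] by auto

text \<open>The fractions \<open>a = y / x\<close> and \<open>b = z / x\<close> have bounded denominators \<open>x\<^sup>m\<close> and \<open>x\<^sup>n\<close> for all their
  powers. In \<open>(y z / x)\<^sup>q = x\<^sup>q a\<^sup>q b\<^sup>q\<close> the factor \<open>x\<^sup>q\<close> clears both of them once \<open>q \<ge> m + n\<close>.\<close>

lemma product_power_in_R:
  assumes x: "x \<in> nonzerodivisors R" and y: "y \<in> carrier R" and z: "z \<in> carrier R"
    and int: "quot_elem R y x \<in> integral_closure R" "quot_elem R z x \<in> integral_closure R"
  shows "\<exists>N. \<forall>q \<ge> N. quot_elem R (y \<otimes> z) x [^]\<^bsub>Q\<^esub> (q::nat) \<in> \<iota> ` carrier R"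
proof -
  let ?K = "\<iota> ` carrier R"
  define w a b where "w = \<iota> x" and "a = quot_elem R y x" and "b = quot_elem R z x"
  have xR: "x \<in> carrier R" using x by simp
  have w: "w \<in> ?K" unfolding w_def using xR by (rule imageI)
  have car: "w \<in> carrier Q" "a \<in> carrier Q" "b \<in> carrier Q"
    and ints: "integral_over Q ?K a" "integral_over Q ?K b"
    using w subringE(1)[OF quot_embed_subring] int by (auto simp: integral_closure_def a_def b_def)
  have mult: "w \<otimes>\<^bsub>Q\<^esub> quot_elem R c x = \<iota> c" if "c \<in> carrier R" for c
    unfolding w_def quot_embed_def quot_elem_def total_quotient_ring_def
    using that x xR one_denom denom_mult by (simp, intro mk_frac_eqI) (auto simp: m_ac)
  have wa: "w \<otimes>\<^bsub>Q\<^esub> a \<in> ?K" and wb: "w \<otimes>\<^bsub>Q\<^esub> b \<in> ?K"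
    unfolding a_def b_def mult[OF y] mult[OF z] using y z by simp_all
  obtain Na :: nat where Na: "\<forall>k::nat. w [^]\<^bsub>Q\<^esub> Na \<otimes>\<^bsub>Q\<^esub> a [^]\<^bsub>Q\<^esub> k \<in> ?K"
    using Q.integral_common_denominator[OF quot_embed_subring car(2) ints(1) w wa] by blast
  obtain Nb :: nat where Nb: "\<forall>k::nat. w [^]\<^bsub>Q\<^esub> Nb \<otimes>\<^bsub>Q\<^esub> b [^]\<^bsub>Q\<^esub> k \<in> ?K"
    using Q.integral_common_denominator[OF quot_embed_subring car(3) ints(2) w wb] by blast
  have u: "quot_elem R (y \<otimes> z) x = w \<otimes>\<^bsub>Q\<^esub> (a \<otimes>\<^bsub>Q\<^esub> b)"
    unfolding w_def a_def b_def quot_embed_def quot_elem_def total_quotient_ring_def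
    using x xR y z one_denom denom_mult by (simp, intro mk_frac_eqI) (auto simp: m_ac)
  have "quot_elem R (y \<otimes> z) x [^]\<^bsub>Q\<^esub> q \<in> ?K" if q: "Na + Nb \<le> q" for q :: nat
  proof -
    have "w [^]\<^bsub>Q\<^esub> q = w [^]\<^bsub>Q\<^esub> (q - (Na + Nb)) \<otimes>\<^bsub>Q\<^esub> (w [^]\<^bsub>Q\<^esub> Na \<otimes>\<^bsub>Q\<^esub> w [^]\<^bsub>Q\<^esub> Nb)"
      using q car by (simp add: Q.nat_pow_mult)
    then have "quot_elem R (y \<otimes> z) x [^]\<^bsub>Q\<^esub> q = w [^]\<^bsub>Q\<^esub> (q - (Na + Nb)) \<otimes>\<^bsub>Q\<^esub>
        ((w [^]\<^bsub>Q\<^esub> Na \<otimes>\<^bsub>Q\<^esub> a [^]\<^bsub>Q\<^esub> q) \<otimes>\<^bsub>Q\<^esub> (w [^]\<^bsub>Q\<^esub> Nb \<otimes>\<^bsub>Q\<^esub> b [^]\<^bsub>Q\<^esub> q))"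
      unfolding u using car by (simp add: Q.nat_pow_distrib Q.m_ac)
    moreover have "w [^]\<^bsub>Q\<^esub> m \<in> ?K" for m :: nat
      using w by (induction m) (auto intro: subringE[OF quot_embed_subring])
    ultimately show ?thesis using Na Nb subringE(6)[OF quot_embed_subring] by simp
  qed
  then show ?thesis by (intro exI[of _ "Na + Nb"] allI impI)
qed

text \<open>If \<open>(s / x)\<^sup>p\<close> lies in \<open>R\<close>, then \<open>s\<^sup>p\<close> is a multiple of \<open>x\<^sup>p\<close>. As the Frobenius map is pure, \<open>s\<close> is a
  multiple of \<open>x\<close>, so \<open>s / x\<close> lies in \<open>R\<close>. An exponent \<open>p\<^sup>e\<close> is reached by iteration.\<close>

lemma F_pure_root:
  fixes p :: nat
  assumes pure: "F_pure p R" and u: "u \<in> carrier Q" and up: "u [^]\<^bsub>Q\<^esub> (p ^ e) \<in> \<iota> ` carrier R"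
  shows "u \<in> \<iota> ` carrier R"
  using up
proof (induction e)
  case 0
  then show ?case using u by simp
next
  case (Suc e)
  have "v \<in> \<iota> ` carrier R" if v: "v \<in> carrier Q" and vp: "v [^]\<^bsub>Q\<^esub> p \<in> \<iota> ` carrier R" for v
  proof -
    obtain s x where sx: "s \<in> carrier R" "x \<in> nonzerodivisors R" "v = quot_elem R s x"
      using v unfolding total_quotient_ring_def quot_elem_def by (rule localization_cases)
    obtain c where c: "c \<in> carrier R" "v [^]\<^bsub>Q\<^esub> p = \<iota> c" using vp by blast
    have "quot_elem R (s [^] p) (x [^] p) = \<iota> c"
      using c(2) mk_frac_pow(2)[OF sx(1,2), of p]
      unfolding sx(3) quot_elem_def total_quotient_ring_def by simp
    then have "s [^] p = x [^] p \<otimes> c"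
      using quot_embed_eq_iff[OF _ mk_frac_pow(1)[OF sx(1,2), of p] c(1), of "s [^] p"] sx(1) by simp
    then obtain r where "r \<in> carrier R" "s = x \<otimes> r"
      using pure_hom_contract_principal[OF is_cring is_cring pure[unfolded F_pure_def], of x s c]
        sx c by auto
    then show ?thesis
      using quot_embed_eq_iff[OF sx(1,2), of r] sx(3) by blast
  qed
  from this[of "u [^]\<^bsub>Q\<^esub> (p ^ e)"] Suc u show ?case
    by (simp add: Q.nat_pow_pow mult.commute)
qed

text \<open>The elements of the total quotient ring with some \<open>p\<close>-power in \<open>R\<close> form a subring \<open>B\<close>, by additivity of
  the Frobenius map. It is integral over \<open>R\<close>, being made of roots, and weakly subintegral over \<open>R\<close>.
  A weakly normal ring therefore contains \<open>B\<close>.\<close>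

lemma weakly_normal_root:
  fixes p :: nat
  assumes p: "Factorial_Ring.prime p" and char: "[p] \<cdot> \<one> = \<zero>" and nontriv: "\<one> \<noteq> \<zero>"
    and normal: "weakly_normal R"
    and u: "u \<in> carrier Q" and up: "u [^]\<^bsub>Q\<^esub> (p ^ e) \<in> \<iota> ` carrier R"
  shows "u \<in> \<iota> ` carrier R"
proof -
  let ?K = "\<iota> ` carrier R"
  define B where "B = {b \<in> carrier Q. \<exists>e. b [^]\<^bsub>Q\<^esub> (p ^ e) \<in> ?K}"
  note K = subringE[OF quot_embed_subring]
  have charQ: "[p] \<cdot>\<^bsub>Q\<^esub> \<one>\<^bsub>Q\<^esub> = \<zero>\<^bsub>Q\<^esub>"
    using add_pow_one_hom[OF ring_axioms Q.ring_axioms quot_embed_hom, of p] char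
      ring_hom_zero[OF quot_embed_hom ring_axioms Q.ring_axioms] by simp
  have powK: "k [^]\<^bsub>Q\<^esub> (n::nat) \<in> ?K" if "k \<in> ?K" for k n
    using that by (induction n) (auto intro: K)
  have common: "\<exists>e. b [^]\<^bsub>Q\<^esub> (p ^ e) \<in> ?K \<and> c [^]\<^bsub>Q\<^esub> (p ^ e) \<in> ?K"
    if "b \<in> B" "c \<in> B" for b c
  proof -
    obtain e1 e2 where e: "b \<in> carrier Q" "c \<in> carrier Q"
        "b [^]\<^bsub>Q\<^esub> (p ^ e1) \<in> ?K" "c [^]\<^bsub>Q\<^esub> (p ^ e2) \<in> ?K"
      using \<open>b \<in> B\<close> \<open>c \<in> B\<close> unfolding B_def by blast
    have "b [^]\<^bsub>Q\<^esub> (p ^ (e1 + e2)) \<in> ?K"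
      using powK[OF e(3), of "p ^ e2"] e(1) by (simp add: Q.nat_pow_pow power_add)
    moreover have "c [^]\<^bsub>Q\<^esub> (p ^ (e1 + e2)) \<in> ?K"
      using powK[OF e(4), of "p ^ e1"] e(2) by (simp add: Q.nat_pow_pow power_add mult.commute)
    ultimately show ?thesis by blast
  qed
  have KB: "?K \<subseteq> B"
  proof
    fix k assume k: "k \<in> ?K"
    then have "k \<in> carrier Q" using K(1) by blast
    then have "k [^]\<^bsub>Q\<^esub> (p ^ 0) \<in> ?K" using k by simp
    then show "k \<in> B" using \<open>k \<in> carrier Q\<close> unfolding B_def by blast
  qed
  have BQ: "B \<subseteq> carrier Q" unfolding B_def by blast
  have Bmult: "b \<otimes>\<^bsub>Q\<^esub> c \<in> B" if bc: "b \<in> B" "c \<in> B" for b c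
  proof -
    obtain e where "b [^]\<^bsub>Q\<^esub> (p ^ e) \<in> ?K" "c [^]\<^bsub>Q\<^esub> (p ^ e) \<in> ?K" using common[OF bc] by blast
    then have "(b \<otimes>\<^bsub>Q\<^esub> c) [^]\<^bsub>Q\<^esub> (p ^ e) \<in> ?K"
      using subsetD[OF BQ bc(1)] subsetD[OF BQ bc(2)] K(6) by (simp add: Q.nat_pow_distrib)
    then show ?thesis using subsetD[OF BQ bc(1)] subsetD[OF BQ bc(2)] unfolding B_def by blast
  qed
  have Badd: "b \<oplus>\<^bsub>Q\<^esub> c \<in> B" if bc: "b \<in> B" "c \<in> B" for b c
  proof -
    obtain e where "b [^]\<^bsub>Q\<^esub> (p ^ e) \<in> ?K" "c [^]\<^bsub>Q\<^esub> (p ^ e) \<in> ?K" using common[OF bc] by blast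
    then have "(b \<oplus>\<^bsub>Q\<^esub> c) [^]\<^bsub>Q\<^esub> (p ^ e) \<in> ?K"
      using subsetD[OF BQ bc(1)] subsetD[OF BQ bc(2)] K(7)
      by (simp add: Q.freshmans_dream_iterated[OF p charQ])
    then show ?thesis using subsetD[OF BQ bc(1)] subsetD[OF BQ bc(2)] unfolding B_def by blast
  qed
  have B: "subring B Q"
  proof (rule Q.subringI)
    show "\<ominus>\<^bsub>Q\<^esub> b \<in> B" if "b \<in> B" for b
    proof -
      \<comment> \<open>Through multiplication by -1, so that the parity of p does not matter.\<close>
      have "\<ominus>\<^bsub>Q\<^esub> b = (\<ominus>\<^bsub>Q\<^esub> \<one>\<^bsub>Q\<^esub>) \<otimes>\<^bsub>Q\<^esub> b" using subsetD[OF BQ that] by (simp add: Q.l_minus)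
      then show ?thesis using Bmult[OF subsetD[OF KB K(5)[OF K(3)]] that] by simp
    qed
  qed (use BQ subsetD[OF KB K(3)] Bmult Badd in auto)
  let ?QB = "Q\<lparr>carrier := B\<rparr>"
  have QB: "cring ?QB"
    using Q.subcring_iff[OF BQ] Q.subcringI'[OF B] by simp
  have hom: "\<iota> \<in> ring_hom R ?QB"
  proof (rule ring_hom_memI)
    show "\<iota> a \<in> carrier ?QB" if "a \<in> carrier R" for a
      using subsetD[OF KB imageI[OF that]] by simp
  qed (simp_all add: ring_hom_mult[OF quot_embed_hom] ring_hom_add[OF quot_embed_hom]
      ring_hom_one[OF quot_embed_hom])
  have "p_radical_extension R ?QB \<iota> p"
  proof (intro p_radical_extension.intro p_radical_extension_axioms.intro
      ring_hom_cring.intro ring_hom_cring_axioms.intro)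
    show "\<one>\<^bsub>?QB\<^esub> \<noteq> \<zero>\<^bsub>?QB\<^esub>" using one_not_zero_Q[OF nontriv] by simp
    show "\<exists>e. b [^]\<^bsub>?QB\<^esub> (p ^ e) \<in> ?K" if "b \<in> carrier ?QB" for b
      using that Q.nat_pow_consistent[of b _ B] by (simp add: B_def)
  qed (use is_cring QB hom p char quot_embed_inj in auto)
  then have ws: "weakly_subintegral R ?QB \<iota>"
    by (rule p_radical_extension.p_radical_imp_weakly_subintegral)
  have "B \<subseteq> integral_closure R"
  proof
    fix b assume b: "b \<in> B"
    then obtain e where e: "b [^]\<^bsub>Q\<^esub> (p ^ e) \<in> ?K" unfolding B_def by blast
    have "0 < p ^ e" using prime_gt_0_nat[OF p] by simp
    then have "integral_over Q ?K b"
      by (rule Q.integral_over_root[OF quot_embed_subring subsetD[OF BQ b] _ e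
          one_not_zero_Q[OF nontriv]])
    then show "b \<in> integral_closure R"
      using subsetD[OF BQ b] by (simp add: integral_closure_def)
  qed
  then have "B \<in> weakly_subintegral_subextensions R"
    using B KB ws by (simp add: weakly_subintegral_subextensions_def)
  then have "B \<subseteq> ?K"
    using normal by (simp add: weakly_normal_def is_weak_normalization_def)
  moreover have "u \<in> B" using u up unfolding B_def by blast
  ultimately show ?thesis by blast
qed

end

section \<open>Weakly Arf rings\<close>

theorem proposition3p7:
  fixes R :: "('a, 'c) ring_scheme" and p :: nat
  assumes "cring R" and "noetherian_ring R"
    and "Factorial_Ring.prime p" and "ring_char R = p"
    and "serre_condition 2 R"
    and "F_pure p R \<or> (weakly_normal R \<and> Mori R)"
  shows "weakly_Arf R"
proof -
  interpret total_quotient R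
    by (intro total_quotient.intro nonzerodivisors_fractions assms(1))
  note p = assms(3)
  have char: "[p] \<cdot>\<^bsub>R\<^esub> \<one>\<^bsub>R\<^esub> = \<zero>\<^bsub>R\<^esub>"
    using add_pow_ring_char assms(4) by simp
  have nontriv: "\<one>\<^bsub>R\<^esub> \<noteq> \<zero>\<^bsub>R\<^esub>"
  proof
    assume "\<one>\<^bsub>R\<^esub> = \<zero>\<^bsub>R\<^esub>"
    then have "ring_char R dvd 1"
      using add.pow_eq_id[of "\<one>\<^bsub>R\<^esub>" 1] unfolding ring_char_def add_pow_def by simp
    then show False using p assms(4) by (simp add: prime_nat_iff)
  qed
  show ?thesis
    unfolding weakly_Arf_def
  proof (intro ballI impI, elim conjE)
    fix x y z
    assume xyz: "x \<in> nonzerodivisors R" "y \<in> carrier R" "z \<in> carrier R"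
      and int: "quot_elem R y x \<in> integral_closure R" "quot_elem R z x \<in> integral_closure R"
    define u where "u = quot_elem R (y \<otimes>\<^bsub>R\<^esub> z) x"
    have u: "u \<in> carrier Q"
      unfolding u_def quot_elem_def total_quotient_ring_def using xyz by simp
    obtain N :: nat where N: "\<forall>q \<ge> N. u [^]\<^bsub>Q\<^esub> q \<in> \<iota> ` carrier R"
      using product_power_in_R[OF xyz int, folded u_def] ..
    \<comment> \<open>Any exponent e with p^e at least N would do.\<close>
    have "N \<le> p ^ N"
      using power_gt_expt[of p N] prime_gt_1_nat[OF p] by simp
    then have root: "u [^]\<^bsub>Q\<^esub> (p ^ N) \<in> \<iota> ` carrier R" by (rule N[rule_format])
    from assms(6) have "u \<in> \<iota> ` carrier R"
    proof (elim disjE conjE)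
      assume "F_pure p R"
      then show ?thesis using u root by (rule F_pure_root)
    next
      assume "weakly_normal R"
      then show ?thesis using u root by (rule weakly_normal_root[OF p char nontriv])
    qed
    then show "quot_elem R (y \<otimes>\<^bsub>R\<^esub> z) x \<in> \<iota> ` carrier R" unfolding u_def .
  qed
qed

end
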